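(* For all integers $n\geqslant 7$ and $2\leqslant m\leqslant n-1$, we have $\kappa(FQ_n; K_{1,m})=\kappa^{s}(FQ_{n};K_{1,m})= \left\lceil\frac{n+1}{2}\right\rceil$.
   Context: All graphs are finite, simple and undirected. The $n$-dimensional hypercube $Q_n$ has as vertices all $n$-bit binary strings $x=x_nx_{n-1}\ldots x_1$, with $x$ adjacent to $y$ iff they differ in exactly one position. The $n$-dimensional folded hypercube $FQ_n$ is obtained from $Q_n$ by adding the $2^{n-1}$ edges $x\overline{x}$, where $\overline{x}=\overline{x_n}\,\overline{x_{n-1}}\ldots\overline{x_1}$ and $\overline{x_i}=1-x_i$. $K_{1,m}$ denotes the star with $m$ leaves. For a set $F$ of subgraphs of a graph $G$, let $V(F)$ be the set of vertices contained in some member of $F$; $F$ is a subgraph cut of $G$ if $G-V(F)$ is disconnected or consists of a single vertex. For a connected graph $H$, an $H$-structure cut is a subgraph cut each of whose members is isomorphic to $H$, and an $H$-substructure cut is a subgraph cut each of whose members is isomorphic to a connected subgraph of $H$. The $H$-structure connectivity $\kappa(G;H)$ (resp. $H$-substructure connectivity $\kappa^s(G;H)$) is the minimum cardinality of an $H$-structure cut (resp. $H$-substructure cut) of $G$. *)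

theory Defs
  imports Complex_Main "HOL-Library.Extended_Nat" "Graph_Theory.Graph_Theory"
begin

text \<open>
  A finite simple undirected graph is a symmetric loop-free finite digraph given by pairs,
  i.e. a member of the locale \<^locale>\<open>pair_graph\<close>: every edge is represented by its two
  orientations. Bit strings of length n are lists of type \<^typ>\<open>bool list\<close>.
\<close>

definition hypercube :: "nat \<Rightarrow> bool list pair_pre_digraph" where
  "hypercube n = \<lparr> pverts = {x. length x = n},
     parcs = {(x, y). length x = n \<and> length y = n \<and> (\<exists>!i. i < n \<and> x ! i \<noteq> y ! i)} \<rparr>"

definition folded_hypercube :: "nat \<Rightarrow> bool list pair_pre_digraph" where
  "folded_hypercube n = \<lparr> pverts = pverts (hypercube n),
     parcs = parcs (hypercube n) \<union> {(x, map Not x) | x. x \<in> pverts (hypercube n)} \<rparr>"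

definition star :: "nat \<Rightarrow> nat pair_pre_digraph" where
  "star m = \<lparr> pverts = {0..m}, parcs = {0} \<times> {1..m} \<union> {1..m} \<times> {0} \<rparr>"

text \<open>
  The library notion \<^const>\<open>subgraph\<close> is about digraphs, hence the additional requirement
  that \<open>S\<close> is itself symmetric.
\<close>

definition graph_subgraph :: "'a pair_pre_digraph \<Rightarrow> 'a pair_pre_digraph \<Rightarrow> bool" where
  "graph_subgraph S G \<longleftrightarrow> pair_graph S \<and> subgraph (with_proj S) (with_proj G)"

definition verts_of :: "'a pair_pre_digraph set \<Rightarrow> 'a set" where
  "verts_of F = (\<Union>S\<in>F. pverts S)"

text \<open>
  The library counts the graph without vertices as not connected. Here it is neither
  disconnected nor a single vertex, so a family covering all of \<open>G\<close> is not a cut.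
\<close>

definition disconnected :: "('a, 'b) pre_digraph \<Rightarrow> bool" where
  "disconnected G \<longleftrightarrow> verts G \<noteq> {} \<and> \<not> connected G"

definition subgraph_cut :: "'a pair_pre_digraph \<Rightarrow> 'a pair_pre_digraph set \<Rightarrow> bool" where
  "subgraph_cut G F \<longleftrightarrow> (\<forall>S\<in>F. graph_subgraph S G) \<and>
     (let R = with_proj G \<restriction> (pverts G - verts_of F) in disconnected R \<or> card (verts R) = 1)"

definition structure_cut ::
  "'a pair_pre_digraph \<Rightarrow> 'b pair_pre_digraph \<Rightarrow> 'a pair_pre_digraph set \<Rightarrow> bool" where
  "structure_cut G H F \<longleftrightarrow> subgraph_cut G F \<and> (\<forall>S\<in>F. digraph_iso (with_proj S) (with_proj H))"

definition substructure_cut ::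
  "'a pair_pre_digraph \<Rightarrow> 'b pair_pre_digraph \<Rightarrow> 'a pair_pre_digraph set \<Rightarrow> bool" where
  "substructure_cut G H F \<longleftrightarrow> subgraph_cut G F \<and>
     (\<forall>S\<in>F. \<exists>T. graph_subgraph T H \<and> connected (with_proj T) \<and>
        digraph_iso (with_proj S) (with_proj T))"

text \<open>
  The minima are taken in \<^typ>\<open>enat\<close>, so that the value is infinite if there is no cut.
  For finite \<open>G\<close> every family of subgraphs of \<open>G\<close> is finite, so \<^const>\<open>card\<close> is
  the true cardinality.
\<close>

definition structure_connectivity :: "'a pair_pre_digraph \<Rightarrow> 'b pair_pre_digraph \<Rightarrow> enat" where
  "structure_connectivity G H = (INF F \<in> {F. structure_cut G H F}. enat (card F))"

definition substructure_connectivity :: "'a pair_pre_digraph \<Rightarrow> 'b pair_pre_digraph \<Rightarrow> enat" where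
  "substructure_connectivity G H = (INF F \<in> {F. substructure_cut G H F}. enat (card F))"

lemma complete_bipartite_star: "K\<^bsub>1,m\<^esub> (with_proj (star m))"
proof -
  have "{0..m} = {0} \<union> {1..m}" by auto
  then show ?thesis
    unfolding complete_bipartite_digraph_pair_def star_def
    by (intro conjI exI[of _ "{0}"] exI[of _ "{1..m}"]) auto
qed

lemma pair_graph_folded_hypercube:
  assumes "n \<ge> 1"
  shows "pair_graph (folded_hypercube n)"
proof -
  have fin: "finite {x :: bool list. length x = n}"
    using finite_lists_length_eq[of "UNIV :: bool set" n] by simp
  have sub: "parcs (folded_hypercube n) \<subseteq> {x. length x = n} \<times> {x. length x = n}"
    by (auto simp: folded_hypercube_def hypercube_def)
  have neq: "map Not x \<noteq> x" if "length x = n" for x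
    using that assms by (cases x) auto
  have sym: "(y, x) \<in> parcs (folded_hypercube n)" if "(x, y) \<in> parcs (folded_hypercube n)" for x y
  proof (cases "y = map Not x")
    case True
    then have "x = map Not y" by (simp add: comp_def)
    moreover have "length y = n" using that sub by auto
    ultimately show ?thesis by (auto simp: folded_hypercube_def hypercube_def)
  next
    case False
    then have "length x = n" "length y = n" "\<exists>!i. i < n \<and> x ! i \<noteq> y ! i"
      using that by (auto simp: folded_hypercube_def hypercube_def)
    moreover have "(y ! i \<noteq> x ! i) = (x ! i \<noteq> y ! i)" for i by blast
    ultimately show ?thesis unfolding folded_hypercube_def hypercube_def by simp
  qed
  show ?thesis
  proof
    show "symmetric (with_proj (folded_hypercube n))"
      using sym by (auto simp: symmetric_def intro!: symI)
    show "finite (pverts (folded_hypercube n))"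
      using fin by (simp add: folded_hypercube_def hypercube_def)
    show "finite (parcs (folded_hypercube n))"
      using finite_subset[OF sub] fin by simp
    show "fst e \<noteq> snd e" if "e \<in> parcs (folded_hypercube n)" for e
    proof
      assume "fst e = snd e"
      with that obtain x where "(x, x) \<in> parcs (folded_hypercube n)" by (metis prod.collapse)
      then have "length x = n" "map Not x = x"
        by (auto simp: folded_hypercube_def hypercube_def)
      with neq show False by blast
    qed
  qed (use sub in \<open>auto simp: folded_hypercube_def hypercube_def\<close>)
qed

end

(* Writing vertices of FQ_n as subsets of {0..<n}, adjacency is addition (symmetric difference)
   of one of n + 1 generators, the n singletons and the full set, whose only linear relation is
   that all of them sum to zero.

   Upper bound: a star centred at the sum of two generators contains both, so the n + 1 neighbours
   of a vertex are paired off by about (n + 1) / 2 stars, which isolate it.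

   Lower bound: let k <= n / 2 stars be removed. In an ordinary cube Q_d a star costs 2 and a single
   point costs 1; if the total cost is less than d, the rest is connected, since a coordinate
   separating two of the removed objects splits Q_d into two halves of smaller cost (a star becomes
   a single point in the half not containing its centre). Fixing two coordinates splits FQ_n into
   four copies of Q_(n-2), and a quarter containing a centres has cost at most k + a. If the
   coordinates put three centres into three different quarters, at most one quarter is too
   expensive, and at most two centres lie outside it. The other quarters are joined by counting.
   Every vertex has a surviving neighbour, as a star covers at most two of its n + 1 neighbours; and
   the six neighbours of two adjacent vertices in the other quarters cannot all be covered by two
   outside centres. *)
theory Submission
  imports Defs
begin

section \<open>Removing stars and points from a cube\<close>


definition sdiff :: "'a set \<Rightarrow> 'a set \<Rightarrow> 'a set" (infixl "\<triangle>" 65) where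
  "A \<triangle> B = (A - B) \<union> (B - A)"

lemma sdiff_iff: "x \<in> A \<triangle> B \<longleftrightarrow> (x \<in> A) \<noteq> (x \<in> B)"
  by (auto simp: sdiff_def)

lemma sdiff_commute: "A \<triangle> B = B \<triangle> A"
  and sdiff_assoc: "(A \<triangle> B) \<triangle> C = A \<triangle> (B \<triangle> C)"
  and sdiff_left_commute: "A \<triangle> (B \<triangle> C) = B \<triangle> (A \<triangle> C)"
  by (auto simp: sdiff_def)

lemmas sdiff_ac = sdiff_commute sdiff_assoc sdiff_left_commute

lemma sdiff_simps [simp]:
  "A \<triangle> A = {}" "A \<triangle> {} = A" "{} \<triangle> A = A" "A \<triangle> (A \<triangle> B) = B" "(B \<triangle> A) \<triangle> A = B"
  "A \<triangle> B = {} \<longleftrightarrow> A = B" "A \<triangle> B = A \<triangle> C \<longleftrightarrow> B = C" "B \<triangle> A = C \<triangle> A \<longleftrightarrow> B = C"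
  by (auto simp: set_eq_iff sdiff_iff)

text \<open>The subcube with free coordinates \<open>D\<close>: \<open>Z\<close> prescribes all
  other coordinates, so it is nonempty exactly when \<open>Z\<close> is disjoint from
  \<open>D\<close>.\<close>

definition cube :: "'a set \<Rightarrow> 'a set \<Rightarrow> 'a set set" where
  "cube D Z = {X. X - D = Z}"

text \<open>Leaves are taken in every direction, so that the same ball serves every subcube and
  contains all stars centred at \<open>c\<close>.\<close>

definition ball_at :: "'a set \<Rightarrow> 'a set set" where
  "ball_at c = insert c {c \<triangle> {e} | e. True}"

definition cube_edges :: "'a set set \<Rightarrow> ('a set \<times> 'a set) set" where
  "cube_edges W = {(X, Y). X \<in> W \<and> Y \<in> W \<and> (\<exists>e. Y = X \<triangle> {e})}"

lemma sdiff_in_cube: "X \<in> cube D Z \<Longrightarrow> X \<triangle> Y \<in> cube D (Z \<triangle> (Y - D))"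
  by (auto simp: cube_def sdiff_def)

lemma cube_eq_image:
  assumes "Z \<inter> D = {}"
  shows "cube D Z = (\<lambda>Y. Z \<union> Y) ` Pow D"
proof (intro equalityI subsetI)
  fix X assume "X \<in> cube D Z"
  then have "X = Z \<union> (X \<inter> D)" by (auto simp: cube_def)
  then show "X \<in> (\<lambda>Y. Z \<union> Y) ` Pow D" by blast
qed (use assms in \<open>auto simp: cube_def\<close>)

lemma card_cube:
  assumes "Z \<inter> D = {}" and "finite D"
  shows "finite (cube D Z)" "card (cube D Z) = 2 ^ card D"
proof -
  have "inj_on (\<lambda>Y. Z \<union> Y) (Pow D)" using assms(1) by (auto simp: inj_on_def)
  then show "finite (cube D Z)" "card (cube D Z) = 2 ^ card D"
    using assms by (simp_all add: cube_eq_image card_image card_Pow)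
qed

lemma ball_at_cube:
  assumes "c \<in> cube D Z"
  shows "ball_at c \<inter> cube D Z \<subseteq> insert c ((\<lambda>e. c \<triangle> {e}) ` D)"
proof
  fix X assume X: "X \<in> ball_at c \<inter> cube D Z"
  show "X \<in> insert c ((\<lambda>e. c \<triangle> {e}) ` D)"
  proof (cases "X = c")
    case False
    then obtain e where e: "X = c \<triangle> {e}" using X by (auto simp: ball_at_def)
    have "X - D = c - D" using X assms by (simp add: cube_def)
    then have "e \<in> D" using e by (auto simp: sdiff_def split: if_splits)
    then show ?thesis using e by blast
  qed simp
qed

lemma card_ball_at_cube:
  assumes "c \<in> cube D Z" and "finite D"
  shows "card (ball_at c \<inter> cube D Z) \<le> card D + 1"
proof -
  have "card (ball_at c \<inter> cube D Z) \<le> card (insert c ((\<lambda>e. c \<triangle> {e}) ` D))"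
    by (rule card_mono) (use ball_at_cube[OF assms(1)] assms in auto)
  also have "\<dots> \<le> card ((\<lambda>e. c \<triangle> {e}) ` D) + 1"
    using card_insert_le_m1 by (simp add: assms card_insert_if)
  also have "\<dots> \<le> card D + 1" using card_image_le[OF assms(2)] by simp
  finally show ?thesis .
qed

lemma card_blocked_cube:
  assumes "finite D" "finite P" "finite C" "C \<subseteq> cube D Z"
    and "S \<inter> cube D Z \<subseteq> P \<union> (\<Union>c\<in>C. ball_at c)" and "Z \<inter> D = {}"
  shows "card (S \<inter> cube D Z) \<le> card P + card C * (card D + 1)"
proof -
  have fin: "finite (cube D Z)" using card_cube assms by blast
  have "card (S \<inter> cube D Z) \<le> card (P \<union> (\<Union>c\<in>C. ball_at c \<inter> cube D Z))"
    by (rule card_mono) (use assms fin in auto)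
  also have "\<dots> \<le> card P + card (\<Union>c\<in>C. ball_at c \<inter> cube D Z)" by (rule card_Un_le)
  also have "card (\<Union>c\<in>C. ball_at c \<inter> cube D Z) \<le> (\<Sum>c\<in>C. card (ball_at c \<inter> cube D Z))"
    by (rule card_UN_le) (fact assms)
  also have "\<dots> \<le> (\<Sum>c\<in>C. card D + 1)"
    by (rule sum_mono) (use card_ball_at_cube assms in blast)
  finally show ?thesis by simp
qed

text \<open>Translation by \<open>Y\<close> matches the two subcubes in \<open>2 ^ card D\<close>
  pairs, and each blocked vertex of either subcube spoils only one of them. Here \<open>Y\<close>
  will be a single coordinate or a generator of the folded cube.\<close>

lemma free_link_exists:
  assumes "finite D" "Z \<inter> D = {}" "Z \<triangle> (Y - D) = Z'"
    and less: "card (S \<inter> cube D Z) + card (S \<inter> cube D Z') < 2 ^ card D"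
  obtains X where "X \<in> cube D Z" "X \<triangle> Y \<in> cube D Z'" "X \<notin> S" "X \<triangle> Y \<notin> S"
proof -
  have Z': "Z' \<inter> D = {}" using assms by (auto simp: sdiff_def)
  have fin: "finite (cube D Z)" "finite (cube D Z')" using card_cube assms Z' by blast+
  let ?K = "(S \<inter> cube D Z) \<union> (\<lambda>X. X \<triangle> Y) ` (S \<inter> cube D Z')"
  have "card ?K \<le> card (S \<inter> cube D Z) + card (S \<inter> cube D Z')"
    by (rule order_trans[OF card_Un_le]) (simp add: card_image_le fin)
  then have "card ?K < card (cube D Z)" using less card_cube(2)[OF assms(2,1)] by simp
  then have "\<not> cube D Z \<subseteq> ?K" using card_mono[of ?K "cube D Z"] fin by auto
  then obtain X where X: "X \<in> cube D Z" "X \<notin> ?K" by blast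
  moreover have XY: "X \<triangle> Y \<in> cube D Z'" using sdiff_in_cube X(1) assms(3) by blast
  moreover have "X \<triangle> Y \<notin> S"
  proof
    assume "X \<triangle> Y \<in> S"
    then have "X \<triangle> Y \<triangle> Y \<in> (\<lambda>X. X \<triangle> Y) ` (S \<inter> cube D Z')" using XY by blast
    then show False using X by simp
  qed
  ultimately show thesis using that by blast
qed

lemma sym_cube_edges: "sym (cube_edges W)"
  unfolding sym_def cube_edges_def by (auto; metis sdiff_simps(5))

lemma cube_edges_mono: "W \<subseteq> W' \<Longrightarrow> cube_edges W \<subseteq> cube_edges W'"
  by (auto simp: cube_edges_def)

lemma quadratic_less_power2: "4 \<le> d \<Longrightarrow> d\<^sup>2 \<le> (2::nat) ^ d"
proof (induction d rule: dec_induct)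
  case (step d)
  then have "2 * d + 1 \<le> d * d"
    using mult_le_mono1[of 4 d d] by linarith
  then show ?case using step by (simp add: power2_eq_square)
qed simp

text \<open>
  \<open>C\<close> holds the centres of the removed stars, \<open>P\<close> the removed single points. The truncated subtraction
  makes the statement hold for \<open>D = {}\<close> too, where nothing is removed.
\<close>

lemma cube_connected:
  assumes "finite D" "Z \<inter> D = {}" "C \<subseteq> cube D Z" "P \<subseteq> cube D Z" "C \<subseteq> S"
    and "S \<inter> cube D Z \<subseteq> P \<union> (\<Union>c\<in>C. ball_at c)"
    and "2 * card C + card P \<le> card D - 1"
    and "X \<in> cube D Z - S" "Y \<in> cube D Z - S"
  shows "(X, Y) \<in> (cube_edges (cube D Z - S))\<^sup>*"
  using assms
proof (induction "card D" arbitrary: D Z C P X Y)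
  case 0
  then have "D = {}" by simp
  then show ?case using 0 by (auto simp: cube_def)
next
  case (Suc d)
  let ?W = "cube D Z - S"
  have finC: "finite C" and finP: "finite P"
    using Suc.prems(3,4) card_cube(1)[OF Suc.prems(2,1)] by (auto intro: finite_subset)
  \<comment> \<open>For \<open>i\<close> in \<open>D\<close> these \<open>Z'\<close> give the two
    halves of the cube in direction \<open>i\<close>; keeping \<open>Z'\<close> symbolic treats both
    at once.\<close>
  define half where "half i Z' \<longleftrightarrow> (Z' = Z \<or> Z' = Z \<triangle> {i})" for i Z'
  have half_disj: "Z' \<inter> (D - {i}) = {}" and half_other: "half i (Z' \<triangle> {i})"
    if "half i Z'" for i Z' using that Suc.prems(2) by (auto simp: half_def sdiff_def)
  have half_un: "cube D Z = cube (D - {i}) Z' \<union> cube (D - {i}) (Z' \<triangle> {i})"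
    if "i \<in> D" "half i Z'" for i Z'
  proof -
    have "i \<notin> Z" using that Suc.prems(2) by blast
    moreover have "cube D Z = cube (D - {i}) Z \<union> cube (D - {i}) (Z \<triangle> {i})"
      using that(1) \<open>i \<notin> Z\<close> Suc.prems(2) unfolding cube_def sdiff_def
      by (auto; blast)
    ultimately show ?thesis using that(2) by (auto simp: half_def)
  qed
  have half_flip: "T \<triangle> {i} \<in> cube (D - {i}) (Z' \<triangle> {i}) \<longleftrightarrow> T \<in> cube (D - {i}) Z'" for T i Z'
  proof -
    have *: "T \<triangle> {i} \<in> cube (D - {i}) (Z' \<triangle> {i})" if "T \<in> cube (D - {i}) Z'" for T Z'
    proof -
      have "{i} - (D - {i}) = {i}" by blast
      then show ?thesis using sdiff_in_cube[OF that, of "{i}"] by simp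
    qed
    show ?thesis using *[of T Z'] *[of "T \<triangle> {i}" "Z' \<triangle> {i}"] by auto
  qed
  have half_inter: "cube (D - {i}) Z' \<inter> cube (D - {i}) (Z' \<triangle> {i}) = {}" for i Z'
    by (auto simp: cube_def sdiff_def)
  \<comment> \<open>A star centred in the opposite half reaches this half only in the vertex across
    from its centre, so here it counts as a point.\<close>
  have blocked_half: "S \<inter> cube (D - {i}) Z' \<subseteq> (P \<inter> cube (D - {i}) Z') \<union>
      (\<lambda>c. c \<triangle> {i}) ` (C \<inter> cube (D - {i}) (Z' \<triangle> {i})) \<union>
      (\<Union>c\<in>C \<inter> cube (D - {i}) Z'. ball_at c)" if i: "i \<in> D" "half i Z'" for i Z'
  proof
    fix T assume T: "T \<in> S \<inter> cube (D - {i}) Z'"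
    then have "T \<in> cube D Z" using half_un[OF i] by blast
    then consider "T \<in> P" | c where "c \<in> C" "T \<in> ball_at c" using Suc.prems(6) T by blast
    then show "T \<in> (P \<inter> cube (D - {i}) Z') \<union>
      (\<lambda>c. c \<triangle> {i}) ` (C \<inter> cube (D - {i}) (Z' \<triangle> {i})) \<union>
      (\<Union>c\<in>C \<inter> cube (D - {i}) Z'. ball_at c)"
    proof cases
      case 2
      show ?thesis
      proof (cases "c \<in> cube (D - {i}) Z'")
        case False
        then have c: "c \<in> cube (D - {i}) (Z' \<triangle> {i})"
          using 2 Suc.prems(3) half_un[OF i] by blast
        then have "T \<noteq> c" using T half_inter by blast
        then obtain e where e: "T = c \<triangle> {e}" using 2 by (auto simp: ball_at_def)
        have "(T - (D - {i})) = Z'" "c - (D - {i}) = Z' \<triangle> {i}"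
          using T c by (auto simp: cube_def)
        then have "(T - (D - {i})) \<triangle> (c - (D - {i})) = {i}" by (simp add: sdiff_ac)
        moreover have "(T - (D - {i})) \<triangle> (c - (D - {i})) \<subseteq> {e}" by (auto simp: sdiff_def e)
        ultimately have "e = i" by auto
        then show ?thesis using 2 c e by blast
      qed (use 2 in blast)
    qed (use T in blast)
  qed
  show ?case
  proof (cases "\<exists>c. C \<union> P \<subseteq> {c}")
    \<comment> \<open>Nothing is removed, or everything sits at a single vertex: the half avoiding
      that vertex is connected by induction, and the other half attaches to it.\<close>
    case True
    \<comment> \<open>\<open>Z\<close> is the default for \<open>c\<close> when nothing is
      removed.\<close>
    have "Z \<in> cube D Z" using Suc.prems(2) by (auto simp: cube_def)
    moreover obtain c0 where "C \<union> P \<subseteq> {c0}" using True by blast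
    moreover have "C \<union> P \<subseteq> cube D Z" using Suc.prems(3,4) by blast
    ultimately obtain c where c: "C \<union> P \<subseteq> {c}" "c \<in> cube D Z"
      by (cases "c0 \<in> cube D Z") blast+
    obtain i where i: "i \<in> D" using Suc.hyps(2) by fastforce
    obtain Z' where Z': "half i Z'" "c \<in> cube (D - {i}) (Z' \<triangle> {i})"
    proof -
      have "half i Z" "half i (Z \<triangle> {i})" by (auto simp: half_def)
      then show thesis using half_un[OF i, of Z] c(2) that by force
    qed
    let ?H = "cube (D - {i}) Z'"
    have empty: "C \<inter> ?H = {}" "P \<inter> ?H = {}" using c Z' half_inter by blast+
    have blocked: "S \<inter> ?H \<subseteq> (\<lambda>c. c \<triangle> {i}) ` C"
      using blocked_half[OF i Z'(1)] empty by auto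
    have H: "?H \<subseteq> cube D Z" using half_un[OF i Z'(1)] by blast
    have conn: "(X', Y') \<in> (cube_edges (?H - S))\<^sup>*" if "X' \<in> ?H - S" "Y' \<in> ?H - S" for X' Y'
    proof (rule Suc.hyps(1)[where C = "{}" and P = "(\<lambda>c. c \<triangle> {i}) ` C"])
      show "d = card (D - {i})" using Suc.hyps(2) i Suc.prems(1) by simp
      show "(\<lambda>c. c \<triangle> {i}) ` C \<subseteq> ?H"
        using c Z' half_flip[of _ i "Z' \<triangle> {i}"] by auto
      \<comment> \<open>If \<open>C\<close> is nonempty, a star of cost 2 becomes a point of cost 1,
        which pays for the lost dimension. If \<open>C\<close> is empty, nothing is removed from
        this half.\<close>
      have "card ((\<lambda>c. c \<triangle> {i}) ` C) \<le> card C" using finC by (rule card_image_le)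
      then show "2 * card ({} :: 'a set set) + card ((\<lambda>c. c \<triangle> {i}) ` C) \<le> card (D - {i}) - 1"
        using Suc.prems(7) Suc.hyps(2) i Suc.prems(1)
        by (cases "card C = 0") (auto simp: card_Diff_singleton)
      show "S \<inter> ?H \<subseteq> (\<lambda>c. c \<triangle> {i}) ` C \<union> (\<Union>c\<in>{}. ball_at c)" using blocked by simp
    qed (use that Suc.prems half_disj[OF Z'(1)] in auto)
    \<comment> \<open>A vertex of the other half crosses along \<open>i\<close>. The vertex across
      is blocked only if the crossing vertex is itself a centre, hence in \<open>S\<close>.\<close>
    have attach: "\<exists>X'\<in>?H - S. (T, X') \<in> (cube_edges ?W)\<^sup>*" if T: "T \<in> ?W" for T
    proof (cases "T \<in> ?H")
      case False
      then have "T \<in> cube (D - {i}) (Z' \<triangle> {i})" using T half_un[OF i Z'(1)] by blast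
      then have T': "T \<triangle> {i} \<in> ?H" using half_flip[of T i "Z' \<triangle> {i}"] by simp
      moreover have "T \<triangle> {i} \<notin> S"
      proof
        assume "T \<triangle> {i} \<in> S"
        then obtain c' where "c' \<in> C" "T \<triangle> {i} = c' \<triangle> {i}" using blocked T' by blast
        then show False using T Suc.prems(5) by auto
      qed
      ultimately have "(T, T \<triangle> {i}) \<in> cube_edges ?W" using T H by (auto simp: cube_edges_def)
      then show ?thesis using T' \<open>T \<triangle> {i} \<notin> S\<close> by blast
    qed (use T in blast)
    obtain X' where X': "X' \<in> ?H - S" "(X, X') \<in> (cube_edges ?W)\<^sup>*" using attach Suc.prems by blast
    obtain Y' where Y': "Y' \<in> ?H - S" "(Y, Y') \<in> (cube_edges ?W)\<^sup>*" using attach Suc.prems by blast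
    have "(X', Y') \<in> (cube_edges ?W)\<^sup>*"
      using conn[OF X'(1) Y'(1)] rtrancl_mono[OF cube_edges_mono, of "?H - S" ?W] H by blast
    moreover have "(Y', Y) \<in> (cube_edges ?W)\<^sup>*"
      using Y'(2) sym_rtrancl[OF sym_cube_edges] by (meson symE)
    ultimately show ?thesis using X'(2) by (meson rtrancl_trans)
  next
    case False
    then have "C \<union> P \<noteq> {}" by auto
    then obtain c1 where c1: "c1 \<in> C \<union> P" by blast
    obtain c2 where c2: "c2 \<in> C \<union> P" "c1 \<noteq> c2" using False by blast
    have cD: "c1 - D = Z" "c2 - D = Z" using c1 c2 Suc.prems(3,4) by (auto simp: cube_def)
    \<comment> \<open>A coordinate separating two removed objects, so that each half contains at
      least one.\<close>
    obtain i where i: "i \<in> c1 \<triangle> c2" using c2(2) by (metis all_not_in_conv sdiff_simps(6))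
    then have iD: "i \<in> D" using cD by (auto simp: sdiff_def)
    have dsuc: "card (D - {i}) = d" using Suc.hyps(2) iD Suc.prems(1) by simp
    have sep: "(C \<union> P) \<inter> cube (D - {i}) Z' \<noteq> {}" if "half i Z'" for Z'
    proof -
      have "c1 \<in> cube (D - {i}) Z' \<longleftrightarrow> c2 \<notin> cube (D - {i}) Z'"
        using that cD iD i Suc.prems(2) c1 c2 by (auto simp: half_def cube_def sdiff_def)
      then show ?thesis using c1 c2 by blast
    qed
    have cardC: "card C = card (C \<inter> cube (D - {i}) Z') + card (C \<inter> cube (D - {i}) (Z' \<triangle> {i}))"
      and cardP: "card P = card (P \<inter> cube (D - {i}) Z') + card (P \<inter> cube (D - {i}) (Z' \<triangle> {i}))"
      if "half i Z'" for Z'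
    proof -
      have "C = (C \<inter> cube (D - {i}) Z') \<union> (C \<inter> cube (D - {i}) (Z' \<triangle> {i}))"
           "P = (P \<inter> cube (D - {i}) Z') \<union> (P \<inter> cube (D - {i}) (Z' \<triangle> {i}))"
        using half_un[OF iD that] Suc.prems(3,4) by blast+
      then show "card C = card (C \<inter> cube (D - {i}) Z') + card (C \<inter> cube (D - {i}) (Z' \<triangle> {i}))"
         "card P = card (P \<inter> cube (D - {i}) Z') + card (P \<inter> cube (D - {i}) (Z' \<triangle> {i}))"
        using half_inter[of i Z'] finC finP
        by (metis (no_types, lifting) card_Un_disjoint finite_Int inf.assoc inf_bot_right inf_left_commute)+
    qed
    define Q where "Q Z' = (P \<inter> cube (D - {i}) Z') \<union>
      (\<lambda>c. c \<triangle> {i}) ` (C \<inter> cube (D - {i}) (Z' \<triangle> {i}))" for Z'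
    have cardQ: "card (Q Z') \<le> card (P \<inter> cube (D - {i}) Z') + card (C \<inter> cube (D - {i}) (Z' \<triangle> {i}))" for Z'
      unfolding Q_def
      by (rule order_trans[OF card_Un_le]) (simp add: card_image_le finC)
    have finQ: "finite (Q Z')" for Z' using finC finP by (simp add: Q_def)
    have conn: "(X', Y') \<in> (cube_edges ?W)\<^sup>*"
      if Z': "half i Z'" and XY: "X' \<in> cube (D - {i}) Z' - S" "Y' \<in> cube (D - {i}) Z' - S" for X' Y' Z'
    proof -
      have "(X', Y') \<in> (cube_edges (cube (D - {i}) Z' - S))\<^sup>*"
      proof (rule Suc.hyps(1)[where C = "C \<inter> cube (D - {i}) Z'" and P = "Q Z'"])
        show "S \<inter> cube (D - {i}) Z' \<subseteq> Q Z' \<union> (\<Union>c\<in>C \<inter> cube (D - {i}) Z'. ball_at c)"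
          using blocked_half[OF iD Z'] by (simp add: Q_def)
        show "Q Z' \<subseteq> cube (D - {i}) Z'"
          using half_flip[of _ i "Z' \<triangle> {i}"] by (auto simp: Q_def)
        \<comment> \<open>The object in the opposite half lowers the cost here by at least 1: a star
          drops from 2 to 1, a point from 1 to 0.\<close>
        have "C \<inter> cube (D - {i}) (Z' \<triangle> {i}) \<noteq> {} \<or> P \<inter> cube (D - {i}) (Z' \<triangle> {i}) \<noteq> {}"
          using sep[OF half_other[OF Z']] by blast
        then have "card (C \<inter> cube (D - {i}) (Z' \<triangle> {i})) + card (P \<inter> cube (D - {i}) (Z' \<triangle> {i})) \<ge> 1"
          using finC finP by (metis One_nat_def Suc_leI add_gr_0 card_gt_0_iff finite_Int)
        then show "2 * card (C \<inter> cube (D - {i}) Z') + card (Q Z') \<le> card (D - {i}) - 1"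
          using cardQ[of Z'] cardC[OF Z'] cardP[OF Z'] Suc.prems(7) Suc.hyps(2) dsuc by linarith
      qed (use XY dsuc Suc.prems half_disj[OF Z'] in auto)
      then show ?thesis
        using rtrancl_mono[OF cube_edges_mono, of "cube (D - {i}) Z' - S" ?W] half_un[OF iD Z'] by blast
    qed
    have halfZ: "half i Z" "half i (Z \<triangle> {i})" by (simp_all add: half_def)
    have bound: "card (S \<inter> cube (D - {i}) Z') \<le> card (Q Z') + card (C \<inter> cube (D - {i}) Z') * (d + 1)"
      if "half i Z'" for Z'
      using card_blocked_cube[of "D - {i}" "Q Z'" "C \<inter> cube (D - {i}) Z'" Z' S]
        blocked_half[OF iD that] finQ finC Suc.prems(1) half_disj[OF that] dsuc by (simp add: Q_def)
    \<comment> \<open>Both halves are connected; a surviving edge between them exists once fewer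
      than \<open>2 ^ d\<close> vertices are blocked in total.\<close>
    have "card (S \<inter> cube (D - {i}) Z) + card (S \<inter> cube (D - {i}) (Z \<triangle> {i})) \<le>
        card P + card C + card C * (d + 1)"
      using bound[OF halfZ(1)] bound[OF halfZ(2)] cardQ[of Z] cardQ[of "Z \<triangle> {i}"]
        cardC[OF halfZ(1)] cardP[OF halfZ(1)] by (simp add: algebra_simps)
    also have "\<dots> < 2 ^ d"
    proof (cases "card C = 0")
      case True
      then have "card P \<le> d" using Suc.prems(7) Suc.hyps(2) by simp
      then show ?thesis using True less_exp[of d] by (simp add: le_less_trans)
    next
      case C: False
      have "card C + card P \<ge> 2"
        using c1 c2 card_Un_le[of C P] card_mono[of "C \<union> P" "{c1, c2}"] finC finP by force
      then have "d \<ge> 3" using C Suc.prems(7) Suc.hyps(2) by linarith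
      \<comment> \<open>The blocked vertices number at most \<open>d * d / 2 + d\<close>, just below
        half of the square of \<open>d + 1\<close>. Using \<open>d + 1\<close> also admits
        \<open>d = 3\<close>.\<close>
      then have "(d + 1)\<^sup>2 \<le> 2 ^ (d + 1)" by (intro quadratic_less_power2) simp
      then have sq: "d * d + 2 * d + 1 \<le> 2 * 2 ^ d" by (simp add: power2_eq_square)
      have "2 * card C * d \<le> d * d"
        using Suc.prems(7) Suc.hyps(2) by (intro mult_le_mono1) simp
      moreover have "card P + card C + card C * (d + 1) = card C * d + (2 * card C + card P)"
        by (simp add: algebra_simps)
      moreover have "2 * card C + card P \<le> d" using Suc.prems(7) Suc.hyps(2) by simp
      ultimately show ?thesis using sq by linarith
    qed
    finally obtain T where T: "T \<in> cube (D - {i}) Z" "T \<triangle> {i} \<in> cube (D - {i}) (Z \<triangle> {i})"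
      "T \<notin> S" "T \<triangle> {i} \<notin> S"
      using free_link_exists[of "D - {i}" Z "{i}" "Z \<triangle> {i}" S thesis] Suc.prems(1) half_disj[OF halfZ(1)] dsuc
      by (auto simp: card_Diff_singleton)
    have step: "(T, T \<triangle> {i}) \<in> cube_edges ?W"
      using T half_un[OF iD halfZ(1)] by (auto simp: cube_edges_def)
    have to_T: "(U, T) \<in> (cube_edges ?W)\<^sup>*" if "U \<in> ?W" for U
    proof (cases "U \<in> cube (D - {i}) Z")
      case False
      then have "U \<in> cube (D - {i}) (Z \<triangle> {i}) - S" using that half_un[OF iD halfZ(1)] by blast
      then have "(U, T \<triangle> {i}) \<in> (cube_edges ?W)\<^sup>*" using conn[OF halfZ(2)] T by blast
      moreover have "(T \<triangle> {i}, T) \<in> cube_edges ?W" using step sym_cube_edges by (metis symE)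
      ultimately show ?thesis by (rule rtrancl_into_rtrancl)
    qed (use that T conn[OF halfZ(1)] in blast)
    have "(T, Y) \<in> (cube_edges ?W)\<^sup>*"
      using to_T[OF Suc.prems(9)] sym_rtrancl[OF sym_cube_edges] by (meson symE)
    then show ?thesis using to_T[OF Suc.prems(8)] by (rule rtrancl_trans[rotated])
  qed
qed

section \<open>Removing stars from a folded cube\<close>


definition gen :: "nat \<Rightarrow> nat \<Rightarrow> nat set" where
  "gen n e = (if e < n then {e} else {..<n})"

text \<open>
  \<open>gen_sum n T\<close> is the sum of the generators indexed by \<open>T\<close>, for \<open>T\<close> a subset of \<open>{..n}\<close>. Short relations
  between generators are refuted by pulling them back to index sets.
\<close>

definition gen_sum :: "nat \<Rightarrow> nat set \<Rightarrow> nat set" where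
  "gen_sum n T = (T \<inter> {..<n}) \<triangle> (if n \<in> T then {..<n} else {})"

definition fold_ball :: "nat \<Rightarrow> nat set \<Rightarrow> nat set set" where
  "fold_ball n c = insert c {c \<triangle> gen n e | e. e \<le> n}"

lemma gen_sum_sdiff: "gen_sum n (T \<triangle> T') = gen_sum n T \<triangle> gen_sum n T'"
  by (auto simp: gen_sum_def sdiff_def)

lemma gen_sum_singleton: "e \<le> n \<Longrightarrow> gen_sum n {e} = gen n e"
  by (auto simp: gen_sum_def gen_def)

lemma gen_sum_empty: "gen_sum n {} = {}"
  by (simp add: gen_sum_def)

text \<open>The only nonempty index set with sum zero is \<open>{..n}\<close>. If \<open>T\<close>
  and \<open>T'\<close> differed, their symmetric difference would be this set, which has too many
  elements.\<close>

lemma gen_sum_inject: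
  assumes "gen_sum n T = gen_sum n T'" "T \<subseteq> {..n}" "T' \<subseteq> {..n}" "card T + card T' \<le> n"
  shows "T = T'"
proof (rule ccontr)
  assume "T \<noteq> T'"
  have fin: "finite T" "finite T'" using assms finite_subset by blast+
  have z: "gen_sum n (T \<triangle> T') = {}" using assms(1) by (simp add: gen_sum_sdiff)
  have sub: "T \<triangle> T' \<subseteq> {..n}" using assms by (auto simp: sdiff_def)
  have "T \<triangle> T' = {..n}"
  proof (cases "n \<in> T \<triangle> T'")
    case True
    then have "{..<n} \<subseteq> T \<triangle> T'" using z by (auto simp: gen_sum_def)
    then show ?thesis using True sub by (auto simp: le_less)
  next
    case False
    then have "(T \<triangle> T') \<inter> {..<n} = {}" using z by (simp add: gen_sum_def)
    moreover have "T \<triangle> T' \<subseteq> {..<n}" using sub False by (auto simp: subset_iff le_less)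
    ultimately have "T \<triangle> T' = {}" by blast
    then show ?thesis using \<open>T \<noteq> T'\<close> by simp
  qed
  then have "n + 1 \<le> card (T \<union> T')"
    using card_mono[of "T \<union> T'" "{..n}"] fin by (auto simp: sdiff_def)
  then show False using card_Un_le[of T T'] assms(4) by linarith
qed

lemma gen_inject: "a \<le> n \<Longrightarrow> b \<le> n \<Longrightarrow> n \<ge> 2 \<Longrightarrow> gen n a = gen n b \<longleftrightarrow> a = b"
  using gen_sum_inject[of n "{a}" "{b}"] by (auto simp: gen_sum_singleton)

lemma gen_nonempty: "n \<ge> 1 \<Longrightarrow> gen n a \<noteq> {}"
  by (auto simp: gen_def lessThan_empty_iff)

lemma gen_subset: "gen n a \<subseteq> {..<n}"
  by (auto simp: gen_def)

text \<open>This turns coverage by a star into a statement about index sets, to which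
  \<open>gen_sum_inject\<close> applies.\<close>

lemma fold_ball_iff_gen_sum:
  "X \<in> fold_ball n c \<longleftrightarrow> (\<exists>T \<subseteq> {..n}. card T \<le> 1 \<and> X \<triangle> c = gen_sum n T)"
proof
  assume "X \<in> fold_ball n c"
  then consider "X = c" | e where "e \<le> n" "X = c \<triangle> gen n e" by (auto simp: fold_ball_def)
  then show "\<exists>T \<subseteq> {..n}. card T \<le> 1 \<and> X \<triangle> c = gen_sum n T"
  proof cases
    case 1
    then show ?thesis by (intro exI[of _ "{}"]) (simp add: gen_sum_empty)
  next
    case 2
    then show ?thesis by (intro exI[of _ "{e}"]) (simp add: gen_sum_singleton sdiff_ac)
  qed
next
  assume "\<exists>T \<subseteq> {..n}. card T \<le> 1 \<and> X \<triangle> c = gen_sum n T"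
  then obtain T where T: "T \<subseteq> {..n}" "card T \<le> 1" "X \<triangle> c = gen_sum n T" by blast
  have "finite T" using T finite_subset by blast
  have X: "X = c \<triangle> (X \<triangle> c)" by (simp add: sdiff_ac)
  consider "T = {}" | e where "T = {e}"
    using T(2) \<open>finite T\<close> by (metis card_0_eq card_1_singletonE le_SucE le_zero_eq One_nat_def)
  then show "X \<in> fold_ball n c"
  proof cases
    case 1
    then show ?thesis using T(3) by (simp add: gen_sum_empty fold_ball_def)
  next
    case 2
    then have "e \<le> n" "X = c \<triangle> gen n e" using T X by (simp_all add: gen_sum_singleton)
    then show ?thesis by (auto simp: fold_ball_def)
  qed
qed

lemma card_sdiff_le: "card (A \<triangle> B) \<le> card A + card B" if "finite A" "finite B"
proof -
  have "card (A \<triangle> B) \<le> card (A \<union> B)" by (rule card_mono) (use that in \<open>auto simp: sdiff_def\<close>)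
  then show ?thesis using card_Un_le[of A B] by linarith
qed

text \<open>Each covered neighbour writes \<open>x \<triangle> c\<close> as a sum of at most two
  generators, one of them \<open>a\<close> or \<open>b\<close> respectively. The two index sets
  together have at most four elements and so coincide.\<close>

lemma covered_twice:
  assumes "n \<ge> 4" "x \<noteq> c" "a \<le> n" "b \<le> n" "a \<noteq> b"
    and "x \<triangle> gen n a \<in> fold_ball n c" "x \<triangle> gen n b \<in> fold_ball n c"
  shows "x \<triangle> c = gen n a \<triangle> gen n b"
proof -
  have shape: "\<exists>T \<subseteq> {..n}. card T \<le> 1 \<and> finite T \<and> x \<triangle> c = gen_sum n ({e} \<triangle> T)"
    if e: "e \<le> n" and cov: "x \<triangle> gen n e \<in> fold_ball n c" for e
  proof -
    obtain T where T: "T \<subseteq> {..n}" "card T \<le> 1" "x \<triangle> gen n e \<triangle> c = gen_sum n T"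
      using cov by (auto simp: fold_ball_iff_gen_sum)
    have "x \<triangle> c = gen n e \<triangle> (x \<triangle> gen n e \<triangle> c)" by (simp add: sdiff_ac)
    then have "x \<triangle> c = gen_sum n ({e} \<triangle> T)" using T e by (simp add: gen_sum_sdiff gen_sum_singleton)
    moreover have "finite T" using T(1) finite_subset by blast
    ultimately show ?thesis using T by blast
  qed
  obtain T where T: "T \<subseteq> {..n}" "card T \<le> 1" "finite T" "x \<triangle> c = gen_sum n ({a} \<triangle> T)"
    using shape assms by blast
  obtain T' where T': "T' \<subseteq> {..n}" "card T' \<le> 1" "finite T'" "x \<triangle> c = gen_sum n ({b} \<triangle> T')"
    using shape assms by blast
  have eq: "{a} \<triangle> T = {b} \<triangle> T'"
  proof (rule gen_sum_inject)
    show "card ({a} \<triangle> T) + card ({b} \<triangle> T') \<le> n"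
      using card_sdiff_le[of "{a}" T] card_sdiff_le[of "{b}" T'] T T' assms(1) by simp
  qed (use T T' assms in \<open>auto simp: sdiff_def\<close>)
  \<comment> \<open>As \<open>x\<close> differs from \<open>c\<close>, \<open>T = {a}\<close> is
    excluded; comparing the two index sets then leaves only \<open>T = {b}\<close>.\<close>
  have "{a} \<triangle> T \<noteq> {}" using T(4) assms(2) by (auto simp: gen_sum_empty)
  have card1: "U = {} \<or> (\<exists>u. U = {u})" if "card U \<le> 1" "finite U" for U :: "nat set"
    using that by (metis card_0_eq card_1_singletonE le_SucE le_zero_eq One_nat_def)
  have "T = {b}"
    using card1[OF T(2,3)] card1[OF T'(2,3)] eq \<open>{a} \<triangle> T \<noteq> {}\<close> \<open>a \<noteq> b\<close>
    by (auto simp: sdiff_def split: if_splits)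
  then show ?thesis using T(4) assms by (simp add: gen_sum_sdiff gen_sum_singleton)
qed

text \<open>Three covered directions \<open>e\<close>, \<open>f\<close>, \<open>g\<close> would give
  \<open>x \<triangle> c\<close> both as the sum of \<open>e\<close> and \<open>f\<close> and as the
  sum of \<open>e\<close> and \<open>g\<close>, forcing \<open>f = g\<close>.\<close>

lemma card_covered_le_2:
  assumes "n \<ge> 4" "x \<noteq> c"
  shows "card {e. e \<le> n \<and> x \<triangle> gen n e \<in> fold_ball n c} \<le> 2"
proof (rule ccontr)
  let ?K = "{e. e \<le> n \<and> x \<triangle> gen n e \<in> fold_ball n c}"
  assume "\<not> card ?K \<le> 2"
  then have "3 \<le> card ?K" by simp
  then obtain T where "T \<subseteq> ?K" "card T = 3" by (meson obtain_subset_with_card_n)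
  then obtain e f g where efg: "{e, f, g} \<subseteq> ?K" "e \<noteq> f" "f \<noteq> g" "e \<noteq> g"
    by (auto simp: card_3_iff)
  have "gen n e \<triangle> gen n f = gen n e \<triangle> gen n g"
    using covered_twice[OF assms, of e f] covered_twice[OF assms, of e g] efg by simp
  then show False using efg assms(1) gen_inject[of f n g] by simp
qed

text \<open>The bound starts at 7: for \<open>n = 6\<close> it would compare 36 with 32.\<close>

lemma square_less_power2: "7 \<le> n \<Longrightarrow> n\<^sup>2 < (2::nat) ^ (n - 1)"
proof (induction n rule: dec_induct)
  case (step n)
  have "2 * n + 1 \<le> n * n" using step(1) mult_le_mono1[of 7 n n] by linarith
  moreover have "(2::nat) ^ n = 2 * 2 ^ (n - 1)" using step(1) by (simp flip: power_Suc)
  ultimately show ?case using step by (simp add: power2_eq_square)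
qed simp

text \<open>\<open>C\<close> holds the centres and \<open>S\<close> all removed vertices. Stars
  enter only through the ball around their centre, which covers substars of every size;
  \<open>2 * card C \<le> n\<close> comes from negating the lower bound.\<close>

locale folded_blocking =
  fixes n :: nat and C S :: "nat set set"
  assumes n_ge: "n \<ge> 7"
    and C_subset: "C \<subseteq> Pow {..<n}" "C \<subseteq> S"
    and S_covered: "S \<subseteq> (\<Union>c\<in>C. fold_ball n c)"
    and card_C: "2 * card C \<le> n"
begin

definition fold_edges :: "(nat set \<times> nat set) set" where
  "fold_edges = {(X, Y). X \<in> Pow {..<n} - S \<and> Y \<in> Pow {..<n} - S \<and> (\<exists>e\<le>n. Y = X \<triangle> gen n e)}"

lemma finite_C: "finite C"
  using C_subset(1) by (rule finite_subset) simp

lemma sym_fold_edges: "sym fold_edges"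
proof (rule symI)
  fix X Y assume "(X, Y) \<in> fold_edges"
  moreover have "Y = X \<triangle> gen n e \<Longrightarrow> X = Y \<triangle> gen n e" for e by simp
  ultimately show "(Y, X) \<in> fold_edges" unfolding fold_edges_def by blast
qed

lemma fold_edges_rtrancl_sym: "(X, Y) \<in> fold_edges\<^sup>* \<Longrightarrow> (Y, X) \<in> fold_edges\<^sup>*"
  using sym_rtrancl[OF sym_fold_edges] by (meson symE)

text \<open>A star covers at most two neighbours of a surviving vertex, so all stars together cover
  at most \<open>n\<close> of the \<open>n + 1\<close> directions.\<close>

lemma free_neighbour_exists:
  assumes "x \<notin> S"
  obtains e where "e \<le> n" "x \<triangle> gen n e \<notin> S"
proof -
  let ?K = "\<lambda>c. {e. e \<le> n \<and> x \<triangle> gen n e \<in> fold_ball n c}"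
  have fin: "finite (\<Union>c\<in>C. ?K c)" using finite_C by simp
  have "card (\<Union>c\<in>C. ?K c) \<le> (\<Sum>c\<in>C. card (?K c))" by (rule card_UN_le[OF finite_C])
  also have "\<dots> \<le> (\<Sum>c\<in>C. 2)"
    by (rule sum_mono, rule card_covered_le_2) (use n_ge C_subset assms in auto)
  also have "\<dots> \<le> n" using card_C by simp
  finally have "\<not> {..n} \<subseteq> (\<Union>c\<in>C. ?K c)" using card_mono[OF fin, of "{..n}"] by auto
  then obtain e where e: "e \<le> n" "e \<notin> (\<Union>c\<in>C. ?K c)" by blast
  then have "x \<triangle> gen n e \<notin> S" using S_covered by blast
  then show thesis using that e by blast
qed

section \<open>The four quarters given by two coordinates\<close>

context
  fixes i j :: nat
  assumes ij: "i < n" "j < n" "i \<noteq> j"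
begin

definition D where "D = {..<n} - {i, j}"

lemma D_simps: "finite D" "card D = n - 2"
  using ij by (auto simp: D_def)

lemma quarter_disj: "Z \<subseteq> {i, j} \<Longrightarrow> Z \<inter> D = {}"
  by (auto simp: D_def)

lemma quarter_iff: "X \<subseteq> {..<n} \<Longrightarrow> X \<in> cube D Z \<longleftrightarrow> X \<inter> {i, j} = Z"
  by (auto simp: cube_def D_def)

lemma quarter_subset: "Z \<subseteq> {i, j} \<Longrightarrow> cube D Z \<subseteq> Pow {..<n}"
  using ij by (auto simp: cube_def D_def)

lemma gen_outside:
  "gen n i - D = {i}" "gen n j - D = {j}" "gen n n - D = {i, j}"
  "e \<notin> {i, j, n} \<Longrightarrow> e \<le> n \<Longrightarrow> gen n e - D = {}"
  using ij by (auto simp: gen_def D_def)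

text \<open>Modulo \<open>D\<close> the generators \<open>i\<close>, \<open>j\<close> and
  \<open>n\<close> have three distinct nonzero residues and all others vanish.\<close>

lemma gen_outside_inject:
  assumes "e \<le> n" "f \<le> n" "gen n e - D = gen n f - D" "gen n e - D \<noteq> {}"
  shows "e = f"
proof -
  have "e \<in> {i, j, n}" "f \<in> {i, j, n}" using gen_outside(4) assms by metis+
  then show ?thesis using assms ij by (auto simp: gen_outside doubleton_eq_iff)
qed

text \<open>
  A star centred outside the quarter \<open>cube D Z\<close> meets it in at most one vertex, because the generators
  \<open>i\<close>, \<open>j\<close> and \<open>n\<close>, the only ones leaving a quarter, lead to three different quarters.
\<close>

definition far :: "nat set \<Rightarrow> nat set set" where
  "far Z = (\<Union>c\<in>C - cube D Z. fold_ball n c \<inter> cube D Z)"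

lemma card_far: "finite (far Z)" "card (far Z) \<le> card (C - cube D Z)"
proof -
  have fin: "finite (fold_ball n c)" for c
    unfolding fold_ball_def by (simp add: setcompr_eq_image[of _ "\<lambda>e. e \<le> n"])
  then show "finite (far Z)" using finite_C by (auto simp: far_def)
  have "card (fold_ball n c \<inter> cube D Z) \<le> 1" if c: "c \<notin> cube D Z" for c
  proof -
    have "T = T'" if T: "T \<in> fold_ball n c \<inter> cube D Z" "T' \<in> fold_ball n c \<inter> cube D Z" for T T'
    proof -
      obtain e e' where e: "e \<le> n" "T = c \<triangle> gen n e" "e' \<le> n" "T' = c \<triangle> gen n e'"
        using T c by (auto simp: fold_ball_def)
      have diff: "gen n e - D = Z \<triangle> (c - D)" if "c \<triangle> gen n e \<in> cube D Z" for e
        using that by (auto simp: cube_def sdiff_def)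
      have "Z \<triangle> (c - D) \<noteq> {}" using c by (auto simp: cube_def)
      moreover have "gen n e - D = Z \<triangle> (c - D)" "gen n e' - D = Z \<triangle> (c - D)"
        using diff e T by auto
      ultimately have "e = e'" using gen_outside_inject[of e e'] e by simp
      then show ?thesis using e by simp
    qed
    then show ?thesis using fin by (auto simp: card_le_Suc0_iff_eq)
  qed
  then have "(\<Sum>c\<in>C - cube D Z. card (fold_ball n c \<inter> cube D Z)) \<le> (\<Sum>c\<in>C - cube D Z. 1)"
    by (intro sum_mono) auto
  then show "card (far Z) \<le> card (C - cube D Z)"
    unfolding far_def using card_UN_le[of "C - cube D Z" "\<lambda>c. fold_ball n c \<inter> cube D Z"] finite_C
    by simp
qed

text \<open>Generator \<open>n\<close> leaves the quarter, so a ball around an inner centre looks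
  there like an ordinary cube ball. Outer centres leave only the points in
  \<open>far Z\<close>.\<close>

lemma quarter_covered:
  "S \<inter> cube D Z \<subseteq> far Z \<union> (\<Union>c\<in>C \<inter> cube D Z. ball_at c)"
proof
  fix T assume T: "T \<in> S \<inter> cube D Z"
  then obtain c where c: "c \<in> C" "T \<in> fold_ball n c" using S_covered by blast
  show "T \<in> far Z \<union> (\<Union>c\<in>C \<inter> cube D Z. ball_at c)"
  proof (cases "c \<in> cube D Z")
    case True
    have "T \<in> ball_at c"
    proof (cases "T = c")
      case False
      then obtain e where e: "e \<le> n" "T = c \<triangle> gen n e" using c by (auto simp: fold_ball_def)
      have "gen n e - D = (T - D) \<triangle> (c - D)" by (auto simp: e sdiff_def)
      also have "\<dots> = {}" using T True by (simp add: cube_def)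
      finally have "e \<noteq> n" using gen_outside by auto
      then have "T = c \<triangle> {e}" using e by (simp add: gen_def)
      then show ?thesis by (auto simp: ball_at_def)
    qed (simp add: ball_at_def)
    then show ?thesis using True c by blast
  qed (use T c in \<open>auto simp: far_def\<close>)
qed

text \<open>With \<open>k\<close> centres in all and \<open>a\<close> in the quarter, the cost is
  \<open>2 * a + (k - a) = k + a\<close>. The budget of \<open>cube_connected\<close> is
  \<open>card D - 1 = n - 3\<close>.\<close>

definition good :: "nat set \<Rightarrow> bool" where
  "good Z \<longleftrightarrow> Z \<subseteq> {i, j} \<and> card C + card (C \<inter> cube D Z) \<le> n - 3"

lemma card_C_split: "card C = card (C \<inter> cube D Z) + card (C - cube D Z)"
  using card_Int_Diff[OF finite_C] .

lemma good_quarter_connected: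
  assumes "good Z" "X \<in> cube D Z - S" "Y \<in> cube D Z - S"
  shows "(X, Y) \<in> fold_edges\<^sup>*"
proof -
  have Z: "Z \<subseteq> {i, j}" using assms(1) by (simp add: good_def)
  have "(X, Y) \<in> (cube_edges (cube D Z - S))\<^sup>*"
  proof (rule cube_connected[where C = "C \<inter> cube D Z" and P = "far Z"])
    show "2 * card (C \<inter> cube D Z) + card (far Z) \<le> card D - 1"
      using assms(1) card_far(2)[of Z] card_C_split[of Z] n_ge
      by (simp add: good_def D_simps)
    show "S \<inter> cube D Z \<subseteq> far Z \<union> (\<Union>c\<in>C \<inter> cube D Z. ball_at c)" by (rule quarter_covered)
  qed (use assms D_simps quarter_disj[OF Z] C_subset in \<open>auto simp: far_def\<close>)
  moreover have "cube_edges (cube D Z - S) \<subseteq> fold_edges"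
  proof (clarsimp simp: cube_edges_def fold_edges_def)
    fix X e assume X: "X \<in> cube D Z" "X \<triangle> {e} \<in> cube D Z"
    have "e < n"
    proof -
      have "{e} = X \<triangle> (X \<triangle> {e})" by simp
      also have "\<dots> \<subseteq> {..<n}" using X quarter_subset[OF Z] by (force simp: sdiff_def)
      finally show ?thesis by simp
    qed
    then show "X \<subseteq> {..<n} \<and> X \<triangle> {e} \<subseteq> {..<n} \<and> (\<exists>ea\<le>n. {e} = gen n ea)"
      using X quarter_subset[OF Z] by (auto intro!: exI[of _ e] simp: gen_def)
  qed
  ultimately show ?thesis using rtrancl_mono by blast
qed

lemma card_blocked_quarter:
  assumes "Z \<subseteq> {i, j}"
  shows "card (S \<inter> cube D Z) \<le> card C + card (C \<inter> cube D Z) * (n - 2)"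
proof -
  have "card (S \<inter> cube D Z) \<le> card (far Z) + card (C \<inter> cube D Z) * (card D + 1)"
    by (rule card_blocked_cube)
      (use D_simps card_far finite_C quarter_covered quarter_disj[OF assms] in auto)
  then show ?thesis
    using card_far(2)[of Z] card_C_split[of Z] by (simp add: D_simps)
qed

lemma card_C_two:
  assumes "Z \<noteq> Z'"
  shows "card (C \<inter> cube D Z) + card (C \<inter> cube D Z') \<le> card C"
proof -
  have "(C \<inter> cube D Z) \<inter> (C \<inter> cube D Z') = {}" using assms by (auto simp: cube_def)
  then have "card (C \<inter> cube D Z) + card (C \<inter> cube D Z') = card ((C \<inter> cube D Z) \<union> (C \<inter> cube D Z'))"
    using finite_C by (simp add: card_Un_disjoint)
  also have "\<dots> \<le> card C" by (rule card_mono[OF finite_C]) blast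
  finally show ?thesis .
qed

text \<open>Distinct quarters are joined by \<open>2 ^ (n - 2)\<close> parallel edges of one
  generator. With \<open>k\<close> centres, at most \<open>2 * k + k * (n - 2) = k * n\<close>
  vertices are blocked in the two, which is too few to destroy all these edges.\<close>

lemma good_quarters_connected:
  assumes "good Z" "good Z'" "X \<in> cube D Z - S" "Y \<in> cube D Z' - S"
  shows "(X, Y) \<in> fold_edges\<^sup>*"
proof (cases "Z = Z'")
  case False
  have Z: "Z \<subseteq> {i, j}" "Z' \<subseteq> {i, j}" using assms by (simp_all add: good_def)
  \<comment> \<open>Quarters differing in one coordinate are joined by \<open>i\<close> or
    \<open>j\<close>, diagonally opposite ones by the complement generator \<open>n\<close>.\<close>
  have "\<exists>e\<le>n. gen n e - D = Z \<triangle> Z'"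
  proof -
    have "Z \<triangle> Z' \<subseteq> {i, j}" "Z \<triangle> Z' \<noteq> {}" using Z False by (auto simp: sdiff_def)
    then have "Z \<triangle> Z' = {i} \<or> Z \<triangle> Z' = {j} \<or> Z \<triangle> Z' = {i, j}" by blast
    then show ?thesis using gen_outside ij by (metis less_imp_le order_refl)
  qed
  then obtain e where e: "e \<le> n" "gen n e - D = Z \<triangle> Z'" by blast
  have "card (S \<inter> cube D Z) + card (S \<inter> cube D Z')
      \<le> 2 * card C + (card (C \<inter> cube D Z) + card (C \<inter> cube D Z')) * (n - 2)"
    using card_blocked_quarter[OF Z(1)] card_blocked_quarter[OF Z(2)]
    by (simp add: algebra_simps)
  also have "\<dots> \<le> 2 * card C + card C * (n - 2)"
    using card_C_two[OF False] by simp
  also have "\<dots> = card C * n" using n_ge by (simp add: algebra_simps flip: mult_Suc_right)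
  finally have "2 * (card (S \<inter> cube D Z) + card (S \<inter> cube D Z')) \<le> 2 * card C * n" by simp
  also have "\<dots> \<le> n\<^sup>2" using card_C by (simp add: power2_eq_square)
  also have "\<dots> < 2 * 2 ^ card D"
  proof -
    have "n - 1 = Suc (n - 2)" using n_ge by simp
    then show ?thesis using square_less_power2[OF n_ge] by (simp add: D_simps)
  qed
  finally have "card (S \<inter> cube D Z) + card (S \<inter> cube D Z') < 2 ^ card D" by simp
  then obtain T where T: "T \<in> cube D Z" "T \<triangle> gen n e \<in> cube D Z'" "T \<notin> S" "T \<triangle> gen n e \<notin> S"
    using free_link_exists[of D Z "gen n e" Z' S thesis] D_simps quarter_disj[OF Z(1)] e by auto
  then have "(T, T \<triangle> gen n e) \<in> fold_edges"
    using e quarter_subset Z by (auto simp: fold_edges_def)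
  moreover have "(X, T) \<in> fold_edges\<^sup>*" "(T \<triangle> gen n e, Y) \<in> fold_edges\<^sup>*"
    using good_quarter_connected assms T by blast+
  ultimately show ?thesis by (meson rtrancl_into_rtrancl rtrancl_trans)
qed (use assms good_quarter_connected in blast)

text \<open>Otherwise the three outer neighbours of \<open>x\<close>, and those of an inner
  surviving neighbour \<open>y\<close>, are all covered by at most two outside centres. One centre
  covers two outer neighbours of \<open>x\<close>, which puts it too far from those of
  \<open>y\<close>; the other would then cover all three, against
  \<open>covered_twice\<close>.\<close>

lemma leaves_quarter:
  assumes Z: "Z \<subseteq> {i, j}" and few: "card (C - cube D Z) \<le> 2"
    and x: "x \<in> cube D Z - S"
  obtains (witness) y e where "y \<in> cube D Z - S" "(x, y) \<in> fold_edges\<^sup>*" "e \<in> {i, j, n}" "y \<triangle> gen n e \<notin> S"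
proof (rule ccontr)
  assume "\<not> thesis"
  then have stuck: "y \<triangle> gen n e \<in> S"
    if "y \<in> cube D Z - S" "(x, y) \<in> fold_edges\<^sup>*" "e \<in> {i, j, n}" for y e
    using witness that by blast
  \<comment> \<open>A centre inside the quarter reaches an outer neighbour of \<open>y\<close> only
    through the same generator, so it would be \<open>y\<close> itself.\<close>
  have cov: "\<exists>c\<in>C - cube D Z. y \<triangle> gen n e \<in> fold_ball n c"
    if y: "y \<in> cube D Z - S" "(x, y) \<in> fold_edges\<^sup>*" "e \<in> {i, j, n}" for y e
  proof -
    have "y \<triangle> gen n e \<in> S" using stuck that by blast
    then obtain c where c: "c \<in> C" "y \<triangle> gen n e \<in> fold_ball n c" using S_covered by blast
    have ne: "gen n e - D \<noteq> {}" "e \<le> n" using y(3) gen_outside ij by auto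
    have "c \<notin> cube D Z"
    proof
      assume "c \<in> cube D Z"
      then have out: "(y \<triangle> c) - D = {}" using y by (auto simp: cube_def sdiff_def)
      have "y \<triangle> gen n e \<noteq> c"
      proof
        assume "y \<triangle> gen n e = c"
        then have "gen n e = y \<triangle> c" by auto
        then show False using out ne by simp
      qed
      then obtain f where f: "f \<le> n" "y \<triangle> gen n e = c \<triangle> gen n f"
        using c(2) by (auto simp: fold_ball_def)
      have "gen n f = c \<triangle> (y \<triangle> gen n e)" using f by simp
      then have "gen n f = (y \<triangle> c) \<triangle> gen n e" by (simp add: sdiff_ac)
      then have "gen n f - D = gen n e - D" using out by (auto simp: sdiff_def)
      then have "f = e" using gen_outside_inject[of e f] ne f by simp
      then have "y = c" using f by simp
      then show False using c y C_subset by blast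
    qed
    then show ?thesis using c by blast
  qed
  have A: "finite {i, j, n}" "card {i, j, n} = 3" using ij by auto
  have finR: "finite (C - cube D Z)" using finite_C by simp
  \<comment> \<open>\<open>h\<close> assigns to each outer direction a centre covering it; three
    directions and at most two centres force a repetition.\<close>
  obtain h where h: "\<And>e. e \<in> {i, j, n} \<Longrightarrow> h e \<in> C - cube D Z \<and> x \<triangle> gen n e \<in> fold_ball n (h e)"
    using cov[OF x rtrancl_refl] by metis
  have "h ` {i, j, n} \<subseteq> C - cube D Z" using h by blast
  then have "card (h ` {i, j, n}) < card {i, j, n}"
    using card_mono[OF finR] few A by (metis le_less_trans less_Suc_eq_le numeral_2_eq_2 numeral_3_eq_3)
  then have "\<not> inj_on h {i, j, n}" using pigeonhole by blast
  then obtain a b where ab: "a \<in> {i, j, n}" "b \<in> {i, j, n}" "a \<noteq> b" "h a = h b"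
    unfolding inj_on_def by blast
  let ?c = "h a"
  have le: "e \<le> n" if "e \<in> {i, j, n}" for e using that ij by auto
  have "x \<noteq> ?c" using h[OF ab(1)] x C_subset by blast
  then have xc: "x \<triangle> ?c = gen n a \<triangle> gen n b"
    using covered_twice[of n x ?c a b] n_ge h[OF ab(1)] h[OF ab(2)] ab le by simp
  have "x \<notin> S" using x by blast
  then obtain g where g: "g \<le> n" "x \<triangle> gen n g \<notin> S" by (rule free_neighbour_exists)
  \<comment> \<open>The surviving neighbour lies in the same quarter, since all outer neighbours of
    \<open>x\<close> are assumed blocked.\<close>
  have g_out: "g \<notin> {i, j, n}" using stuck[OF x rtrancl_refl] g by blast
  let ?y = "x \<triangle> gen n g"
  have y: "?y \<in> cube D Z - S"
    using sdiff_in_cube[of x D Z "gen n g"] x g gen_outside(4)[OF g_out] by simp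
  have "(x, ?y) \<in> fold_edges"
    using x y g quarter_subset[OF Z] by (auto simp: fold_edges_def)
  then have xy: "(x, ?y) \<in> fold_edges\<^sup>*" by blast
  have not_c: "?y \<triangle> gen n e \<notin> fold_ball n ?c" if e: "e \<in> {i, j, n}" for e
  proof
    assume "?y \<triangle> gen n e \<in> fold_ball n ?c"
    then obtain T where T: "T \<subseteq> {..n}" "card T \<le> 1" "?y \<triangle> gen n e \<triangle> ?c = gen_sum n T"
      by (auto simp: fold_ball_iff_gen_sum)
    let ?T = "{g} \<triangle> ({e} \<triangle> ({a} \<triangle> {b}))"
    have "?y \<triangle> gen n e \<triangle> ?c = gen n g \<triangle> (gen n e \<triangle> (x \<triangle> ?c))" by (simp add: sdiff_ac)
    then have "gen_sum n ?T = gen_sum n T"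
      using T(3) xc e ab g le by (simp add: gen_sum_sdiff gen_sum_singleton)
    moreover have "card ?T \<le> 4"
    proof -
      have "card ?T \<le> card {g, e, a, b}" by (rule card_mono) (auto simp: sdiff_def)
      also have "\<dots> \<le> 4" using card_length[of "[g, e, a, b]"] by simp
      finally show ?thesis .
    qed
    moreover have "?T \<subseteq> {..n}" using g(1) le[OF e] le[OF ab(1)] le[OF ab(2)] by (auto simp: sdiff_def)
    ultimately have eq: "?T = T" using gen_sum_inject[of n ?T T] T n_ge by auto
    have "finite T" using T(1) finite_subset by blast
    have "g \<in> ?T" using e ab g_out by (auto simp: sdiff_iff)
    \<comment> \<open>Since \<open>a\<close> and \<open>b\<close> differ, \<open>e\<close>,
      \<open>a\<close> and \<open>b\<close> cannot all cancel. With \<open>g\<close> this gives two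
      indices, while \<open>T\<close> has at most one.\<close>
    moreover have "\<exists>u\<in>{e, a, b}. u \<in> ?T" using e ab g_out by (auto simp: sdiff_iff)
    ultimately obtain u where "u \<in> T" "g \<in> T" "u \<noteq> g" using e ab g_out eq by auto
    then show False using T(2) \<open>finite T\<close> by (auto simp: card_le_Suc0_iff_eq)
  qed
  have covy: "\<exists>c\<in>C - cube D Z - {?c}. ?y \<triangle> gen n e \<in> fold_ball n c" if "e \<in> {i, j, n}" for e
    using cov[OF y xy that] not_c[OF that] by blast
  have "card (C - cube D Z - {?c}) \<le> 1" using few h[OF ab(1)] finR by simp
  then have unique: "c = c'" if "c \<in> C - cube D Z - {?c}" "c' \<in> C - cube D Z - {?c}" for c c'
    using that finR by (auto simp: card_le_Suc0_iff_eq)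
  obtain c' where c': "c' \<in> C - cube D Z - {?c}" using covy[of i] by blast
  have cov': "?y \<triangle> gen n e \<in> fold_ball n c'" if "e \<in> {i, j, n}" for e
    using covy[OF that] unique c' by blast
  have "?y \<noteq> c'" using y c' C_subset by blast
  \<comment> \<open>The single remaining centre covers all of \<open>i\<close>, \<open>j\<close> and
    \<open>n\<close> at \<open>?y\<close>.\<close>
  then have "gen n i \<triangle> gen n j = gen n i \<triangle> gen n n"
    using covered_twice[of n ?y c' i j] covered_twice[of n ?y c' i n] cov' n_ge ij by auto
  then show False using gen_inject[of j n n] ij n_ge by simp
qed

text \<open>At most one quarter fails to be good. Vertices in it escape to a good quarter by
  \<open>leaves_quarter\<close>, and the good quarters are connected with each other.\<close>

lemma connected_of_spread:
  assumes spread: "card C \<ge> 3 \<Longrightarrow> \<exists>c1\<in>C. \<exists>c2\<in>C. \<exists>c3\<in>C. c1 \<inter> {i, j} \<noteq> c2 \<inter> {i, j} \<and>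
      c2 \<inter> {i, j} \<noteq> c3 \<inter> {i, j} \<and> c1 \<inter> {i, j} \<noteq> c3 \<inter> {i, j}"
    and X: "X \<in> Pow {..<n} - S" and Y: "Y \<in> Pow {..<n} - S"
  shows "(X, Y) \<in> fold_edges\<^sup>*"
proof -
  have one_bad: "good Z \<or> good Z'" if Z: "Z \<subseteq> {i, j}" "Z' \<subseteq> {i, j}" "Z \<noteq> Z'" for Z Z'
  proof (rule ccontr)
    assume "\<not> (good Z \<or> good Z')"
    then have big: "n - 2 \<le> card C + card (C \<inter> cube D Z)" "n - 2 \<le> card C + card (C \<inter> cube D Z')"
      using Z n_ge by (auto simp: good_def)
    have "card (C \<inter> cube D Z) \<le> card C" by (rule card_mono[OF finite_C]) blast
    \<comment> \<open>One bad quarter already forces three centres, so \<open>spread\<close>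
      supplies one outside both bad quarters. With \<open>k = card C\<close> this gives
      \<open>2 * (n - 2) \<le> 3 * k - 1\<close>, impossible for \<open>2 * k \<le> n\<close> and
      \<open>n \<ge> 7\<close>.\<close>
    then have "card C \<ge> 3" using big n_ge by linarith
    then obtain c where c: "c \<in> C" "c \<inter> {i, j} \<noteq> Z" "c \<inter> {i, j} \<noteq> Z'"
      using spread by metis
    have "c \<subseteq> {..<n}" using c C_subset by blast
    then have notin: "c \<notin> cube D Z" "c \<notin> cube D Z'" using c quarter_iff by blast+
    have "(C \<inter> cube D Z) \<inter> (C \<inter> cube D Z') = {}" using Z by (auto simp: cube_def)
    then have "card (C \<inter> cube D Z) + card (C \<inter> cube D Z') = card ((C \<inter> cube D Z) \<union> (C \<inter> cube D Z'))"
      using finite_C by (simp add: card_Un_disjoint)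
    also have "\<dots> \<le> card (C - {c})" by (rule card_mono) (use finite_C notin in auto)
    also have "\<dots> = card C - 1" using c by simp
    finally show False using big card_C n_ge \<open>card C \<ge> 3\<close> by linarith
  qed
  have reach: "\<exists>Z T. good Z \<and> T \<in> cube D Z - S \<and> (x, T) \<in> fold_edges\<^sup>*" if x: "x \<in> Pow {..<n} - S" for x
  proof -
    define Z where "Z = x \<inter> {i, j}"
    have Z: "Z \<subseteq> {i, j}" "x \<in> cube D Z" using x quarter_iff by (auto simp: Z_def)
    show ?thesis
    proof (cases "good Z")
      case True
      then show ?thesis using Z x by blast
    next
      case False
      then have "n - 2 \<le> card C + card (C \<inter> cube D Z)" using Z n_ge by (auto simp: good_def)
      \<comment> \<open>The number of outside centres is \<open>k - a\<close>, at most
        \<open>2 * k - (n - 2)\<close>, hence at most 2.\<close>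
      then have few: "card (C - cube D Z) \<le> 2" using card_C_split[of Z] card_C by linarith
      obtain y e where ye: "y \<in> cube D Z - S" "(x, y) \<in> fold_edges\<^sup>*" "e \<in> {i, j, n}" "y \<triangle> gen n e \<notin> S"
        using leaves_quarter[OF Z(1) few] x Z by blast
      define Z' where "Z' = Z \<triangle> (gen n e - D)"
      have Z': "Z' \<subseteq> {i, j}" "Z' \<noteq> Z"
        using ye(3) gen_outside Z(1) unfolding Z'_def by (auto simp: sdiff_def)
      have T: "y \<triangle> gen n e \<in> cube D Z' - S" using ye sdiff_in_cube by (auto simp: Z'_def)
      have "e \<le> n" using ye(3) ij by auto
      then have "(y, y \<triangle> gen n e) \<in> fold_edges"
        using ye T quarter_subset[OF Z(1)] quarter_subset[OF Z'(1)] by (auto simp: fold_edges_def)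
      then have "(x, y \<triangle> gen n e) \<in> fold_edges\<^sup>*" using ye(2) by (rule rtrancl_into_rtrancl[rotated])
      moreover have "good Z'" using one_bad[OF Z(1) Z'(1)] Z'(2) False by blast
      ultimately show ?thesis using T by blast
    qed
  qed
  obtain Z T where T: "good Z" "T \<in> cube D Z - S" "(X, T) \<in> fold_edges\<^sup>*" using reach[OF X] by blast
  obtain Z' T' where T': "good Z'" "T' \<in> cube D Z' - S" "(Y, T') \<in> fold_edges\<^sup>*" using reach[OF Y] by blast
  show ?thesis
    using good_quarters_connected[OF T(1) T'(1) T(2) T'(2)] T(3) fold_edges_rtrancl_sym[OF T'(3)]
    by (meson rtrancl_trans)
qed

end

text \<open>Choose \<open>i\<close> separating two of three centres. The third agrees at
  \<open>i\<close> with exactly one of them, and \<open>j\<close> separates this agreeing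
  pair.\<close>

lemma spread_exists:
  assumes "card C \<ge> 3"
  shows "\<exists>i<n. \<exists>j<n. i \<noteq> j \<and> (\<exists>c1\<in>C. \<exists>c2\<in>C. \<exists>c3\<in>C. c1 \<inter> {i, j} \<noteq> c2 \<inter> {i, j} \<and>
      c2 \<inter> {i, j} \<noteq> c3 \<inter> {i, j} \<and> c1 \<inter> {i, j} \<noteq> c3 \<inter> {i, j})"
proof -
  have split: "\<exists>i<n. i \<in> c \<longleftrightarrow> i \<notin> c'" if "c \<in> C" "c' \<in> C" "c \<noteq> c'" for c c'
  proof -
    obtain i where "i \<in> c \<longleftrightarrow> i \<notin> c'" using \<open>c \<noteq> c'\<close> by blast
    then show ?thesis using that C_subset(1) by blast
  qed
  obtain T where "T \<subseteq> C" "card T = 3" using assms by (meson obtain_subset_with_card_n)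
  then obtain a b c where abc: "a \<in> C" "b \<in> C" "c \<in> C" "a \<noteq> b" "b \<noteq> c" "a \<noteq> c"
    by (auto simp: card_3_iff)
  obtain i where i: "i < n" "i \<in> a \<longleftrightarrow> i \<notin> b" using split abc by metis
  obtain u v w where uv: "u \<in> C" "v \<in> C" "u \<noteq> v" "i \<in> u \<longleftrightarrow> i \<in> v"
    and w: "w \<in> C" "i \<in> w \<longleftrightarrow> i \<notin> u"
  proof (cases "i \<in> c \<longleftrightarrow> i \<in> a")
    case True
    show thesis using that[of a c b] abc i True by blast
  next
    case False
    show thesis using that[of b c a] abc i False by blast
  qed
  obtain j where j: "j < n" "j \<in> u \<longleftrightarrow> j \<notin> v" using split[OF uv(1-3)] by blast
  have "i \<noteq> j" using uv j by blast
  moreover have "u \<inter> {i, j} \<noteq> v \<inter> {i, j}" "v \<inter> {i, j} \<noteq> w \<inter> {i, j}" "u \<inter> {i, j} \<noteq> w \<inter> {i, j}"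
    using uv(4) w j by blast+
  ultimately show ?thesis using i j uv w by blast
qed

theorem complement_connected:
  assumes "X \<in> Pow {..<n} - S" "Y \<in> Pow {..<n} - S"
  shows "(X, Y) \<in> fold_edges\<^sup>*"
proof (cases "card C \<ge> 3")
  case True
  then show ?thesis using spread_exists connected_of_spread assms by metis
next
  case False
  \<comment> \<open>With at most two centres the spread condition is vacuous, so any two coordinates
    serve.\<close>
  then show ?thesis using connected_of_spread[of 0 1] assms n_ge by simp
qed

lemma card_complement: "card (Pow {..<n} - S) \<noteq> 1"
proof
  assume "card (Pow {..<n} - S) = 1"
  then obtain x where x: "Pow {..<n} - S = {x}" by (auto simp: card_1_singleton_iff)
  then have "x \<notin> S" by blast
  then obtain e where e: "e \<le> n" "x \<triangle> gen n e \<notin> S" by (rule free_neighbour_exists)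
  have "x \<triangle> gen n e \<in> Pow {..<n}" using x gen_subset[of n e] by (auto simp: sdiff_def)
  then have "x \<triangle> gen n e = x" using x e by blast
  then have "x \<triangle> gen n e = x \<triangle> {}" by simp
  then show False using gen_nonempty[of n e] n_ge by (simp del: sdiff_simps(2))
qed

end

section \<open>Structure cuts of the folded hypercube\<close>


definition bits :: "bool list \<Rightarrow> nat set" where
  "bits x = {i. i < length x \<and> x ! i}"

definition of_bits :: "nat \<Rightarrow> nat set \<Rightarrow> bool list" where
  "of_bits n X = map (\<lambda>i. i \<in> X) [0..<n]"

lemma length_of_bits [simp]: "length (of_bits n X) = n"
  by (simp add: of_bits_def)

lemma bits_of_bits [simp]: "X \<subseteq> {..<n} \<Longrightarrow> bits (of_bits n X) = X"
  by (auto simp: bits_def of_bits_def)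

lemma of_bits_bits [simp]: "length x = n \<Longrightarrow> of_bits n (bits x) = x"
  by (auto simp: bits_def of_bits_def intro: nth_equalityI)

lemma bits_subset: "length x = n \<Longrightarrow> bits x \<subseteq> {..<n}"
  by (auto simp: bits_def)

lemma bits_inject: "length x = length y \<Longrightarrow> bits x = bits y \<longleftrightarrow> x = y"
  by (metis of_bits_bits)

lemma pverts_folded [simp]: "pverts (folded_hypercube n) = {x. length x = n}"
  by (simp add: folded_hypercube_def hypercube_def)

lemma hypercube_arc_iff:
  assumes "length x = n" "length y = n"
  shows "(\<exists>!i. i < n \<and> x ! i \<noteq> y ! i) \<longleftrightarrow> (\<exists>e<n. bits y = bits x \<triangle> {e})"
proof -
  have diff: "bits x \<triangle> bits y = {i. i < n \<and> x ! i \<noteq> y ! i}"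
    using assms by (auto simp: bits_def sdiff_def)
  have "(\<exists>!i. i < n \<and> x ! i \<noteq> y ! i) \<longleftrightarrow> (\<exists>e. {i. i < n \<and> x ! i \<noteq> y ! i} = {e})"
    unfolding Ex1_def set_eq_iff by (intro iff_exI) auto
  also have "\<dots> \<longleftrightarrow> (\<exists>e<n. bits x \<triangle> bits y = {e})"
    unfolding diff by (intro iff_exI) auto
  also have "\<dots> \<longleftrightarrow> (\<exists>e<n. bits y = bits x \<triangle> {e})"
    by (metis sdiff_simps(4))
  finally show ?thesis .
qed

lemma folded_arc_iff:
  "(x, y) \<in> parcs (folded_hypercube n) \<longleftrightarrow>
    length x = n \<and> length y = n \<and> (\<exists>e\<le>n. bits y = bits x \<triangle> gen n e)"
proof (cases "length x = n \<and> length y = n")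
  case True
  then have len: "length x = n" "length y = n" by blast+
  have "y = map Not x \<longleftrightarrow> bits y = bits (map Not x)" using len by (simp add: bits_inject)
  also have "bits (map Not x) = bits x \<triangle> gen n n"
    using len by (auto simp: bits_def sdiff_def gen_def)
  finally have "(x, y) \<in> parcs (folded_hypercube n) \<longleftrightarrow>
      (\<exists>e<n. bits y = bits x \<triangle> gen n e) \<or> bits y = bits x \<triangle> gen n n"
    using len hypercube_arc_iff[OF len]
    by (auto simp: folded_hypercube_def hypercube_def gen_def)
  then show ?thesis using len by (auto simp: le_less)
qed (auto simp: folded_hypercube_def hypercube_def)

lemma bits_neighbour_in_fold_ball:
  "(x, y) \<in> parcs (folded_hypercube n) \<Longrightarrow> bits y \<in> fold_ball n (bits x)"
  by (auto simp: folded_arc_iff fold_ball_def)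

section \<open>Centres of connected substars\<close>

lemma reachable_first_step:
  assumes "u \<rightarrow>\<^sup>*\<^bsub>G\<^esub> v" "u \<noteq> v"
  obtains w where "u \<rightarrow>\<^bsub>G\<^esub> w"
  using reachable_rtranclI[OF assms(1)] assms(2) by (blast elim: converse_rtranclE)

text \<open>If \<open>0\<close> is present, every other vertex has an arc by connectedness, and that
  arc can only go to \<open>0\<close>. If \<open>0\<close> is absent, no arcs remain and
  \<open>T\<close> is a single vertex.\<close>

lemma connected_star_subgraph_centre:
  assumes "graph_subgraph T (star m)" "connected (with_proj T)"
  obtains c where "c \<in> pverts T" "\<And>v. v \<in> pverts T \<Longrightarrow> v = c \<or> (c, v) \<in> parcs T"
proof -
  interpret T: pair_graph T using assms(1) by (simp add: graph_subgraph_def)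
  have arcs: "parcs T \<subseteq> parcs (star m)"
    using assms(1) by (simp add: graph_subgraph_def subgraph_def)
  have reach: "u \<rightarrow>\<^sup>*\<^bsub>with_proj T\<^esub> v" if "u \<in> pverts T" "v \<in> pverts T" for u v
    using assms(2) that T.reachable_mk_symmetric_eq[OF T.pair_sym_arcs]
    by (simp add: connected_def strongly_connected_def mk_symmetric_def)
  have ne: "pverts T \<noteq> {}"
    using assms(2) by (simp add: connected_def strongly_connected_def mk_symmetric_def)
  show thesis
  proof (cases "0 \<in> pverts T")
    case True
    have "v = 0 \<or> (0, v) \<in> parcs T" if v: "v \<in> pverts T" for v
    proof (cases "v = 0")
      case False
      then obtain w where "v \<rightarrow>\<^bsub>with_proj T\<^esub> w"
        using reachable_first_step[OF reach[OF v True]] by blast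
      then have vw: "(v, w) \<in> parcs T" by simp
      then have "w = 0" using arcs False by (auto simp: star_def)
      moreover have "(w, v) \<in> parcs T"
        using vw T.pair_sym_arcs by (auto simp: symmetric_def dest: symD)
      ultimately show ?thesis by blast
    qed simp
    then show thesis using that True by blast
  next
    case False
    obtain c where c: "c \<in> pverts T" using ne by blast
    have "v = c" if v: "v \<in> pverts T" for v
    proof (rule ccontr)
      assume "v \<noteq> c"
      then obtain w where "v \<rightarrow>\<^bsub>with_proj T\<^esub> w"
        using reachable_first_step[OF reach[OF v c]] by blast
      then have vw: "(v, w) \<in> parcs T" by simp
      then have "v = 0 \<or> w = 0" using arcs by (auto simp: star_def)
      then show False using T.wellformed'[OF vw] \<open>0 \<notin> pverts T\<close> by metis
    qed
    then show thesis using that c by blast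
  qed
qed

lemma iso_star_centre:
  assumes "pair_graph S" "digraph_iso (with_proj S) (with_proj T)"
    and "c \<in> pverts T" "\<And>v. v \<in> pverts T \<Longrightarrow> v = c \<or> (c, v) \<in> parcs T"
  shows "\<exists>c'\<in>pverts S. \<forall>v\<in>pverts S. v = c' \<or> (c', v) \<in> parcs S"
proof -
  interpret S: pair_graph S by fact
  obtain f where f: "pre_digraph.digraph_isomorphism (with_proj S) f" "with_proj T = app_iso f (with_proj S)"
    using assms(2) by (auto simp: digraph_iso_def)
  \<comment> \<open>Comparing the fields of the two digraphs also identifies the tail and head maps
    of the isomorphism with \<open>fst\<close> and \<open>snd\<close>.\<close>
  have T: "pverts T = iso_verts f ` pverts S" "parcs T = iso_arcs f ` parcs S"
    "fst = iso_tail f" "snd = iso_head f"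
    using arg_cong[OF f(2), of verts] arg_cong[OF f(2), of arcs]
      arg_cong[OF f(2), of tail] arg_cong[OF f(2), of head] by simp_all
  have inj: "inj_on (iso_verts f) (pverts S)"
    and ends: "\<And>a. a \<in> parcs S \<Longrightarrow> iso_verts f (fst a) = iso_tail f (iso_arcs f a)
      \<and> iso_verts f (snd a) = iso_head f (iso_arcs f a)"
    using f(1) by (auto simp: pre_digraph.digraph_isomorphism_def)
  obtain c' where c': "c' \<in> pverts S" "c = iso_verts f c'" using assms(3) T by blast
  have "v = c' \<or> (c', v) \<in> parcs S" if v: "v \<in> pverts S" for v
  proof -
    have "iso_verts f v \<in> pverts T" using v T by blast
    then consider "iso_verts f v = c" | "(c, iso_verts f v) \<in> parcs T" using assms(4) by blast
    then show ?thesis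
    proof cases
      case 1
      then show ?thesis using inj v c' by (auto dest: inj_onD)
    next
      case 2
      then obtain a where a: "a \<in> parcs S" "iso_arcs f a = (c, iso_verts f v)" using T(2) by force
      then have "iso_verts f (fst a) = iso_verts f c'" "iso_verts f (snd a) = iso_verts f v"
        using ends[OF a(1)] c' by (simp_all flip: T(3,4))
      then have "a = (c', v)"
        using inj v c' S.arc_fst_in_verts[OF a(1)] S.arc_snd_in_verts[OF a(1)]
        by (metis inj_onD prod.collapse)
      then show ?thesis using a by blast
    qed
  qed
  then show ?thesis using c' by blast
qed

lemma substructure_star_centre:
  assumes "graph_subgraph S G" "graph_subgraph T (star m)" "connected (with_proj T)"
    "digraph_iso (with_proj S) (with_proj T)"
  shows "\<exists>c\<in>pverts S. \<forall>v\<in>pverts S. v = c \<or> (c, v) \<in> parcs G"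
proof -
  obtain c where c: "c \<in> pverts T" "\<And>v. v \<in> pverts T \<Longrightarrow> v = c \<or> (c, v) \<in> parcs T"
    using connected_star_subgraph_centre[OF assms(2,3)] by blast
  have S: "pair_graph S" "parcs S \<subseteq> parcs G"
    using assms(1) by (simp_all add: graph_subgraph_def subgraph_def)
  show ?thesis using iso_star_centre[OF S(1) assms(4) c] S(2) by blast
qed

section \<open>Lower bound for substructure cuts\<close>

lemma finite_subgraph_family:
  assumes "finite (pverts G)" "finite (parcs G)" "\<forall>S\<in>F. graph_subgraph S G"
  shows "finite F"
proof (rule finite_subset)
  show "F \<subseteq> (\<lambda>(V, A). \<lparr>pverts = V, parcs = A\<rparr>) ` (Pow (pverts G) \<times> Pow (parcs G))"
  proof
    fix S assume "S \<in> F"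
    then have "pverts S \<subseteq> pverts G" "parcs S \<subseteq> parcs G"
      using assms(3) by (auto simp: graph_subgraph_def subgraph_def)
    then show "S \<in> (\<lambda>(V, A). \<lparr>pverts = V, parcs = A\<rparr>) ` (Pow (pverts G) \<times> Pow (parcs G))"
      by (intro rev_image_eqI[of "(pverts S, parcs S)"]) auto
  qed
qed (use assms in simp)

text \<open>A smaller family yields an instance of \<open>folded_blocking\<close>, and
  \<open>bits\<close> transfers the connected complement back to the hypercube.\<close>

lemma substructure_cut_card_ge:
  assumes n: "n \<ge> 7" and cut: "substructure_cut (folded_hypercube n) (star m) F"
  shows "n div 2 + 1 \<le> card F"
proof (rule ccontr)
  assume "\<not> n div 2 + 1 \<le> card F"
  then have small: "2 * card F \<le> n" by linarith
  let ?G = "folded_hypercube n"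
  interpret G: pair_graph ?G using pair_graph_folded_hypercube n by simp
  have sub: "\<forall>S\<in>F. graph_subgraph S ?G"
    using cut by (simp add: substructure_cut_def subgraph_cut_def)
  have fin: "finite F"
    using finite_subgraph_family[OF _ _ sub] G.pair_finite_verts G.pair_finite_arcs by blast
  have "\<forall>S\<in>F. \<exists>c\<in>pverts S. \<forall>v\<in>pverts S. v = c \<or> (c, v) \<in> parcs ?G"
    using cut sub substructure_star_centre unfolding substructure_cut_def by blast
  then obtain cen where cen: "\<And>S. S \<in> F \<Longrightarrow> cen S \<in> pverts S"
    "\<And>S v. S \<in> F \<Longrightarrow> v \<in> pverts S \<Longrightarrow> v = cen S \<or> (cen S, v) \<in> parcs ?G"
    by metis
  have len: "length v = n" if "S \<in> F" "v \<in> pverts S" for S v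
    using sub that by (auto simp: graph_subgraph_def subgraph_def)
  define C where "C = (\<lambda>S. bits (cen S)) ` F"
  define B where "B = bits ` verts_of F"
  interpret folded_blocking n C B
  proof
    show "C \<subseteq> Pow {..<n}" using len cen(1) bits_subset by (fastforce simp: C_def)
    show "C \<subseteq> B" using cen(1) by (auto simp: C_def B_def verts_of_def)
    show "B \<subseteq> (\<Union>c\<in>C. fold_ball n c)"
    proof
      fix X assume "X \<in> B"
      then obtain S v where S: "S \<in> F" "v \<in> pverts S" "X = bits v"
        by (auto simp: B_def verts_of_def)
      then have "X \<in> fold_ball n (bits (cen S))"
        using cen(2)[OF S(1,2)] bits_neighbour_in_fold_ball by (auto simp: fold_ball_def)
      then show "X \<in> (\<Union>c\<in>C. fold_ball n c)" using S by (auto simp: C_def)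
    qed
    \<comment> \<open>Different stars may share a centre, so the number of centres is only bounded
      by \<open>card F\<close>.\<close>
    show "2 * card C \<le> n" using small card_image_le[OF fin, of "\<lambda>S. bits (cen S)"]
      unfolding C_def by linarith
  qed (fact n)
  let ?W = "pverts ?G - verts_of F"
  let ?R = "with_proj ?G \<restriction> ?W"
  have len_verts: "length v = n" if "v \<in> verts_of F" for v
    using that len by (auto simp: verts_of_def)
  have bits_W: "bits x \<in> Pow {..<n} - B" if "x \<in> ?W" for x
  proof -
    have "bits x \<notin> B"
    proof
      assume "bits x \<in> B"
      then obtain y where y: "y \<in> verts_of F" "bits x = bits y" by (auto simp: B_def)
      then have "x = y" using bits_inject[of x y] len_verts that by simp
      then show False using y that by blast
    qed
    then show ?thesis using that bits_subset by auto
  qed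
  have of_bits_W: "of_bits n X \<in> ?W" if "X \<in> Pow {..<n} - B" for X
  proof -
    have "of_bits n X \<notin> verts_of F"
    proof
      assume "of_bits n X \<in> verts_of F"
      then have "bits (of_bits n X) \<in> B" unfolding B_def by blast
      then show False using that by simp
    qed
    then show ?thesis by simp
  qed
  have "bij_betw bits ?W (Pow {..<n} - B)"
    by (rule bij_betw_byWitness[where f' = "of_bits n"]) (use bits_W of_bits_W in auto)
  then have card_W: "card ?W \<noteq> 1" using bij_betw_same_card card_complement by metis
  have wf: "wf_digraph ?R" by (rule G.wellformed_induce_subgraph)
  have path: "of_bits n X \<rightarrow>\<^sup>*\<^bsub>?R\<^esub> of_bits n Y"
    if "(X, Y) \<in> fold_edges\<^sup>*" "X \<in> Pow {..<n} - B" for X Y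
    using that(1)
  proof (induction rule: rtrancl_induct)
    case base
    then show ?case using wf_digraph.reachable_refl[OF wf] of_bits_W[OF that(2)] by simp
  next
    case (step Y Z)
    then have YZ: "Y \<in> Pow {..<n} - B" "Z \<in> Pow {..<n} - B" "\<exists>e\<le>n. Z = Y \<triangle> gen n e"
      by (auto simp: fold_edges_def)
    then have "(of_bits n Y, of_bits n Z) \<in> parcs ?G" by (simp add: folded_arc_iff)
    then have "(of_bits n Y, of_bits n Z) \<in> arcs ?R"
      using of_bits_W[OF YZ(1)] of_bits_W[OF YZ(2)] by simp
    then have "of_bits n Y \<rightarrow>\<^bsub>?R\<^esub> of_bits n Z"
      by (force simp: arcs_ends_conv)
    then show ?case using wf_digraph.reachable_adj_trans[OF wf step.IH] by blast
  qed
  have "u \<rightarrow>\<^sup>*\<^bsub>?R\<^esub> v" if "u \<in> ?W" "v \<in> ?W" for u v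
    using path[OF complement_connected[OF bits_W[OF that(1)] bits_W[OF that(2)]] bits_W[OF that(1)]] that
    by simp
  then have "\<not> disconnected ?R"
    using wf_digraph.reachable_mk_symmetricI[OF wf]
    by (auto simp: disconnected_def connected_def strongly_connected_def mk_symmetric_def)
  then show False
    using cut card_W by (simp add: substructure_cut_def subgraph_cut_def Let_def)
qed

section \<open>Upper bound: stars isolating a vertex\<close>

definition star_at :: "'a \<Rightarrow> 'a set \<Rightarrow> 'a pair_pre_digraph" where
  "star_at c L = \<lparr>pverts = insert c L, parcs = {c} \<times> L \<union> L \<times> {c}\<rparr>"

lemma star_eq_star_at: "star m = star_at 0 {1..m}"
  by (auto simp: star_def star_at_def)

lemma pair_graph_star_at:
  assumes "finite L" "c \<notin> L"
  shows "pair_graph (star_at c L)"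
proof
  show "symmetric (with_proj (star_at c L))"
    by (auto simp: symmetric_def star_at_def intro!: symI)
qed (use assms in \<open>auto simp: star_at_def\<close>)

lemma graph_subgraph_star_at:
  assumes "pair_graph G" "c \<in> pverts G" "c \<notin> L" "{c} \<times> L \<subseteq> parcs G"
  shows "graph_subgraph (star_at c L) G"
proof -
  interpret G: pair_graph G by fact
  have L: "L \<subseteq> pverts G" using assms(4) G.in_arcsD2 by blast
  then have fin: "finite L" using G.pair_finite_verts finite_subset by blast
  interpret T: pair_graph "star_at c L" using pair_graph_star_at fin assms(3) .
  have "(v, c) \<in> parcs G" if "v \<in> L" for v
    using that assms(4) G.pair_sym_arcs by (auto simp: symmetric_def dest: symD)
  then have "subgraph (with_proj (star_at c L)) (with_proj G)"
    using assms L G.wf_digraph_axioms T.wf_digraph_axioms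
    by (auto simp: subgraph_def compatible_def star_at_def)
  then show ?thesis using T.pair_graph_axioms by (simp add: graph_subgraph_def)
qed

lemma digraph_iso_star_at:
  assumes "finite L" "c \<notin> L" "finite L'" "c' \<notin> L'" "card L = card L'"
  shows "digraph_iso (with_proj (star_at c L)) (with_proj (star_at c' L'))"
proof -
  interpret T: pair_graph "star_at c L" using pair_graph_star_at assms(1,2) .
  obtain g where g: "bij_betw g L L'" using finite_same_card_bij assms by blast
  define f where "f v = (if v = c then c' else g v)" for v
  have fL: "f ` L = L'" "inj_on f (insert c L)" and fc: "f c = c'"
    using g assms(2,4) by (auto simp: f_def bij_betw_def inj_on_def)
  let ?h = "\<lparr>iso_verts = f, iso_arcs = map_prod f f, iso_head = snd, iso_tail = fst\<rparr>"
  have "inj_on (map_prod f f) (parcs (star_at c L))"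
    by (rule inj_on_subset[OF map_prod_inj_on[OF fL(2) fL(2)]]) (auto simp: star_at_def)
  then have "pre_digraph.digraph_isomorphism (with_proj (star_at c L)) ?h"
    using fL T.wf_digraph_axioms by (auto simp: pre_digraph.digraph_isomorphism_def star_at_def)
  moreover have "map_prod f f ` parcs (star_at c L) = parcs (star_at c' L')"
    using fc by (simp add: star_at_def image_Un image_paired_Times map_prod_def flip: fL(1))
  then have "with_proj (star_at c' L') = app_iso ?h (with_proj (star_at c L))"
    using fc fL(1) by (simp add: with_proj_def app_iso_def) (simp add: star_at_def)
  ultimately show ?thesis unfolding digraph_iso_def by blast
qed

lemma connected_star: "connected (with_proj (star m))"
proof -
  have g: "pair_graph (star m)" by (simp add: star_eq_star_at pair_graph_star_at)
  interpret T: pair_graph "star m" by fact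
  have to: "u \<rightarrow>\<^sup>*\<^bsub>with_proj (star m)\<^esub> 0" if "u \<in> pverts (star m)" for u
  proof (cases "u = 0")
    case False
    then have "(u, 0) \<in> parcs (star m)" using that by (auto simp: star_def)
    then show ?thesis using T.reachable_adjI by blast
  qed (use that T.reachable_refl in blast)
  have "u \<rightarrow>\<^sup>*\<^bsub>with_proj (star m)\<^esub> v" if "u \<in> pverts (star m)" "v \<in> pverts (star m)" for u v
    using to[OF that(1)] symmetric_reachable[OF T.pair_sym_arcs to[OF that(2)]]
    by (rule T.reachable_trans)
  then show ?thesis
    using T.reachable_mk_symmetricI
    by (auto simp: connected_def strongly_connected_def mk_symmetric_def star_def)
qed

text \<open>Hence one lower bound for substructure cuts and one construction of a structure cut
  settle both connectivities.\<close>

lemma structure_cut_imp_substructure_cut: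
  assumes "structure_cut G (star m) F"
  shows "substructure_cut G (star m) F"
proof -
  have g: "pair_graph (star m)" by (simp add: star_eq_star_at pair_graph_star_at)
  then interpret T: pair_graph "star m" .
  have "graph_subgraph (star m) (star m)"
    using g T.wf_digraph_axioms by (simp add: graph_subgraph_def subgraph_def compatible_def)
  then show ?thesis
    using assms connected_star unfolding structure_cut_def substructure_cut_def by blast
qed

lemma isolated_not_connected:
  assumes "z \<in> verts R" "v \<in> verts R" "z \<noteq> v"
    and "\<And>a. a \<in> arcs R \<Longrightarrow> tail R a \<noteq> z \<and> head R a \<noteq> z"
  shows "\<not> connected R"
proof
  assume "connected R"
  then have "z \<rightarrow>\<^sup>*\<^bsub>with_proj (mk_symmetric R)\<^esub> v"
    using assms(1,2) by (simp add: connected_def strongly_connected_def mk_symmetric_def)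
  then obtain w where "z \<rightarrow>\<^bsub>with_proj (mk_symmetric R)\<^esub> w"
    using reachable_first_step assms(3) by metis
  then have "(z, w) \<in> parcs (mk_symmetric R)" by simp
  then show False using assms(4) by (auto simp: mk_symmetric_def)
qed

text \<open>The zero string is isolated: star \<open>t\<close> contains its neighbours
  \<open>2 * t\<close> and \<open>p t\<close>, being centred at the sum of these two
  generators.\<close>

lemma structure_cut_exists:
  assumes n: "n \<ge> 7" and m: "2 \<le> m" "m \<le> n + 1"
  shows "\<exists>F. structure_cut (folded_hypercube n) (star m) F \<and> card F \<le> n div 2 + 1"
proof -
  let ?G = "folded_hypercube n"
  interpret G: pair_graph ?G using pair_graph_folded_hypercube n by simp
  \<comment> \<open>The partner of direction \<open>2 * t\<close> is the next one; for even
    \<open>n\<close> the last direction \<open>n\<close> is left over and is paired with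
    \<open>0\<close>.\<close>
  define p where "p t = (if 2 * t < n then 2 * t + 1 else 0)" for t :: nat
  define c where "c t = gen n (2 * t) \<triangle> gen n (p t)" for t
  have pt: "2 * t \<le> n" "p t \<le> n" "2 * t \<noteq> p t" if "t \<le> n div 2" for t
    using that n by (auto simp: p_def)
  \<comment> \<open>Besides the two prescribed directions, the other \<open>m - 2\<close> leaves of
    a star are arbitrary.\<close>
  have "\<exists>L. L \<subseteq> {..n} \<and> {2 * t, p t} \<subseteq> L \<and> card L = m" if t: "t \<le> n div 2" for t
  proof -
    have "m - 2 \<le> card ({..n} - {2 * t, p t})" using pt[OF t] m by (simp add: card_Diff_subset)
    then obtain K where K: "K \<subseteq> {..n} - {2 * t, p t}" "card K = m - 2" "finite K"
      by (meson obtain_subset_with_card_n)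
    have "{2 * t, p t} \<inter> K = {}" using K(1) by blast
    then have "card ({2 * t, p t} \<union> K) = m" using K pt[OF t] m by (simp add: card_Un_disjoint)
    then show ?thesis using K pt[OF t] by (intro exI[of _ "{2 * t, p t} \<union> K"]) auto
  qed
  then obtain L where L: "\<And>t. t \<le> n div 2 \<Longrightarrow> L t \<subseteq> {..n} \<and> {2 * t, p t} \<subseteq> L t \<and> card (L t) = m"
    by metis
  define leaves where "leaves t = (\<lambda>e. of_bits n (c t \<triangle> gen n e)) ` L t" for t
  have c_sub: "c t \<subseteq> {..<n}" for t
    using gen_subset[of n "2 * t"] gen_subset[of n "p t"] by (auto simp: c_def sdiff_def)
  have ce_sub: "c t \<triangle> gen n e \<subseteq> {..<n}" for t e
    using c_sub[of t] gen_subset[of n e] by (auto simp: sdiff_def)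
  have of_bits_inj: "of_bits n X = of_bits n Y \<longleftrightarrow> X = Y" if "X \<subseteq> {..<n}" "Y \<subseteq> {..<n}" for X Y
    using that by (metis bits_of_bits)
  have c_notin: "of_bits n (c t) \<notin> leaves t" for t
  proof
    assume "of_bits n (c t) \<in> leaves t"
    then obtain e where "of_bits n (c t) = of_bits n (c t \<triangle> gen n e)" by (auto simp: leaves_def)
    then have "c t \<triangle> {} = c t \<triangle> gen n e" using of_bits_inj[OF c_sub ce_sub] by simp
    then show False using gen_nonempty[of n e] n by (simp del: sdiff_simps(2))
  qed
  have card_leaves: "finite (leaves t)" "card (leaves t) = m" if t: "t \<le> n div 2" for t
  proof -
    show "finite (leaves t)" using L[OF t] finite_subset by (auto simp: leaves_def)
    have "inj_on (\<lambda>e. of_bits n (c t \<triangle> gen n e)) (L t)"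
    proof (rule inj_onI)
      fix a b assume ab: "a \<in> L t" "b \<in> L t" "of_bits n (c t \<triangle> gen n a) = of_bits n (c t \<triangle> gen n b)"
      then have "gen n a = gen n b" using of_bits_inj[OF ce_sub ce_sub] by simp
      then show "a = b" using ab L[OF t] gen_inject[of a n b] n by auto
    qed
    then show "card (leaves t) = m" using L[OF t] by (simp add: leaves_def card_image)
  qed
  define F where "F = (\<lambda>t. star_at (of_bits n (c t)) (leaves t)) ` {..n div 2}"
  have sub: "graph_subgraph S ?G" if S: "S \<in> F" for S
  proof -
    obtain t where t: "t \<le> n div 2" "S = star_at (of_bits n (c t)) (leaves t)"
      using S unfolding F_def by blast
    have "(of_bits n (c t), of_bits n (c t \<triangle> gen n e)) \<in> parcs ?G" if "e \<in> L t" for e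
    proof -
      have "e \<le> n" using that L[OF t(1)] by auto
      moreover have "bits (of_bits n (c t \<triangle> gen n e)) = bits (of_bits n (c t)) \<triangle> gen n e"
        by (simp only: bits_of_bits[OF c_sub] bits_of_bits[OF ce_sub])
      ultimately show ?thesis unfolding folded_arc_iff by (metis length_of_bits)
    qed
    then have "{of_bits n (c t)} \<times> leaves t \<subseteq> parcs ?G" unfolding leaves_def by blast
    moreover have "of_bits n (c t) \<in> pverts ?G" by simp
    ultimately show ?thesis
      unfolding t(2) using graph_subgraph_star_at[OF G.pair_graph_axioms _ c_notin] by blast
  qed
  have iso: "digraph_iso (with_proj S) (with_proj (star m))" if S: "S \<in> F" for S
  proof -
    obtain t where t: "t \<le> n div 2" "S = star_at (of_bits n (c t)) (leaves t)"
      using S unfolding F_def by blast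
    show ?thesis unfolding t(2) star_eq_star_at
      by (rule digraph_iso_star_at) (use card_leaves[OF t(1)] c_notin in auto)
  qed
  let ?W = "pverts ?G - verts_of F"
  let ?R = "with_proj ?G \<restriction> ?W"
  let ?z = "of_bits n {}"
  \<comment> \<open>No star contains the zero string: its centre is a sum of two generators, which
    is neither zero nor a single generator.\<close>
  have c_small: "c t \<noteq> {}" "c t \<triangle> gen n e \<noteq> {}" if t: "t \<le> n div 2" "e \<le> n" for t e
  proof -
    have c: "c t = gen_sum n ({2 * t} \<triangle> {p t})"
      using pt[OF t(1)] by (simp add: c_def gen_sum_sdiff gen_sum_singleton)
    have two: "{2 * t} \<triangle> {p t} = {2 * t, p t}" using pt[OF t(1)] by (auto simp: sdiff_def)
    have "{2 * t, p t} \<noteq> {e}" using pt[OF t(1)] by auto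
    then have "gen_sum n {2 * t, p t} \<noteq> gen_sum n {e}"
      using gen_sum_inject[of n "{2 * t, p t}" "{e}"] pt[OF t(1)] t n by auto
    then show "c t \<triangle> gen n e \<noteq> {}" using c two t by (simp add: gen_sum_singleton)
    have "gen n (2 * t) \<noteq> gen n (p t)" using gen_inject pt[OF t(1)] n by simp
    then show "c t \<noteq> {}" by (simp add: c_def)
  qed
  have "?z \<notin> verts_of F"
  proof
    assume "?z \<in> verts_of F"
    then obtain t where t: "t \<le> n div 2" "?z \<in> insert (of_bits n (c t)) (leaves t)"
      by (auto simp: verts_of_def F_def star_at_def)
    then consider "?z = of_bits n (c t)" | e where "e \<in> L t" "?z = of_bits n (c t \<triangle> gen n e)"
      by (auto simp: leaves_def)
    then show False
    proof cases
      case 1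
      then show False using of_bits_inj[OF _ c_sub, of "{}" t] c_small(1)[OF t(1), of 0] by simp
    next
      case 2
      then have "{} = c t \<triangle> gen n e" using of_bits_inj[OF _ ce_sub, of "{}" t e] by simp
      moreover have "e \<le> n" using 2 L[OF t(1)] by auto
      ultimately show False using c_small(2)[OF t(1)] by metis
    qed
  qed
  then have z: "?z \<in> ?W" by simp
  \<comment> \<open>Adding one of the two paired generators to the centre leaves the other, so
    neighbour \<open>e\<close> is a leaf of star \<open>e div 2\<close>.\<close>
  have nbr: "of_bits n (gen n e) \<in> verts_of F" if "e \<le> n" for e
  proof -
    have t: "e div 2 \<le> n div 2" using that by (rule div_le_mono)
    have "e = 2 * (e div 2) \<or> e = p (e div 2)"
      using that by (cases "even e") (auto simp: p_def elim!: oddE)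
    then have "(\<exists>f\<in>{2 * (e div 2), p (e div 2)}. gen n e = c (e div 2) \<triangle> gen n f)"
    proof
      assume "e = 2 * (e div 2)"
      then have "gen n e = c (e div 2) \<triangle> gen n (p (e div 2))"
        by (metis c_def sdiff_simps(5))
      then show ?thesis by blast
    next
      assume "e = p (e div 2)"
      then have "gen n e = c (e div 2) \<triangle> gen n (2 * (e div 2))"
        by (metis c_def sdiff_commute sdiff_simps(5))
      then show ?thesis by blast
    qed
    then obtain f where f: "f \<in> {2 * (e div 2), p (e div 2)}" "gen n e = c (e div 2) \<triangle> gen n f"
      by (elim bexE)
    have "f \<in> L (e div 2)" using f(1) L[OF t] by blast
    then have "of_bits n (gen n e) \<in> leaves (e div 2)"
      unfolding leaves_def f(2) by (rule imageI)
    then show ?thesis using t by (auto simp: verts_of_def F_def star_at_def)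
  qed
  have isolated: "fst a \<noteq> ?z \<and> snd a \<noteq> ?z" if a: "a \<in> arcs ?R" for a
  proof -
    have no: "w \<notin> ?W" if "(?z, w) \<in> parcs ?G" for w
    proof -
      obtain e where "e \<le> n" "bits w = gen n e" "length w = n"
        using \<open>(?z, w) \<in> parcs ?G\<close> by (auto simp: folded_arc_iff)
      then show ?thesis using nbr[of e] of_bits_bits[of w n] by auto
    qed
    obtain u w where uw: "a = (u, w)" "(u, w) \<in> parcs ?G" "u \<in> ?W" "w \<in> ?W"
      using a by (cases a) auto
    moreover have "(w, u) \<in> parcs ?G"
      using uw(2) G.pair_sym_arcs by (auto simp: symmetric_def dest: symD)
    ultimately show ?thesis using no by auto
  qed
  have "disconnected ?R \<or> card (verts ?R) = 1"
  \<comment> \<open>If the isolated vertex is all that remains, the single-vertex clause of a cut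
    applies.\<close>
  proof (cases "?W = {?z}")
    case True
    then show ?thesis by simp
  next
    case False
    then obtain v where "v \<in> ?W" "v \<noteq> ?z" using z by blast
    then have "\<not> connected ?R"
      using z isolated by (intro isolated_not_connected[of ?z _ v]) auto
    moreover have "verts ?R \<noteq> {}" using z by (metis empty_iff induce_subgraph_verts)
    ultimately show ?thesis by (simp add: disconnected_def)
  qed
  then have "structure_cut ?G (star m) F"
    using sub iso by (simp add: structure_cut_def subgraph_cut_def Let_def)
  moreover have "card F \<le> n div 2 + 1"
    using card_image_le[of "{..n div 2}"] unfolding F_def by fastforce
  ultimately show ?thesis by blast
qed

theorem theorem3p7:
  fixes n m :: nat
  assumes "n \<ge> 7" and "2 \<le> m" and "m \<le> n - 1"
  shows "structure_connectivity (folded_hypercube n) (star m) = enat (nat \<lceil>(real n + 1) / 2\<rceil>) \<and>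
         substructure_connectivity (folded_hypercube n) (star m) = enat (nat \<lceil>(real n + 1) / 2\<rceil>)"
proof -
  let ?G = "folded_hypercube n"
  have "\<lceil>(real n + 1) / 2\<rceil> = int (n div 2 + 1)"
  proof (rule ceiling_unique)
    have "n = 2 * (n div 2) \<or> n = 2 * (n div 2) + 1" by presburger
    then have "real n = 2 * real (n div 2) \<or> real n = 2 * real (n div 2) + 1"
      by (metis of_nat_1 of_nat_add of_nat_mult of_nat_numeral)
    then show "real_of_int (int (n div 2 + 1)) - 1 < (real n + 1) / 2"
      "(real n + 1) / 2 \<le> real_of_int (int (n div 2 + 1))" by auto
  qed
  then have ceil: "nat \<lceil>(real n + 1) / 2\<rceil> = n div 2 + 1" by simp
  obtain F where F: "structure_cut ?G (star m) F" "card F \<le> n div 2 + 1"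
  proof -
    have "m \<le> n + 1" using assms(3) by linarith
    then show thesis using structure_cut_exists[OF assms(1,2)] that by blast
  qed
  have lower: "enat (n div 2 + 1) \<le> enat (card F')" if "substructure_cut ?G (star m) F'" for F'
    using substructure_cut_card_ge[OF assms(1) that] by simp
  have "structure_connectivity ?G (star m) \<le> enat (n div 2 + 1)"
    unfolding structure_connectivity_def
    by (rule INF_lower2[of F]) (use F in auto)
  moreover have "substructure_connectivity ?G (star m) \<le> enat (n div 2 + 1)"
    unfolding substructure_connectivity_def
    by (rule INF_lower2[of F]) (use F structure_cut_imp_substructure_cut in auto)
  moreover have "enat (n div 2 + 1) \<le> structure_connectivity ?G (star m)"
    unfolding structure_connectivity_def
    by (rule INF_greatest) (use lower structure_cut_imp_substructure_cut in auto)
  moreover have "enat (n div 2 + 1) \<le> substructure_connectivity ?G (star m)"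
    unfolding substructure_connectivity_def
    by (rule INF_greatest) (use lower in auto)
  ultimately show ?thesis unfolding ceil by (metis antisym)
qed

end
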